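(* Let $s \ge 2$ and $t \ge 0$ be integers. If $A$ and $B$ are disjoint bases of a matroid $M$ with $r(M) \ge 4^{s(s4^s)^t}$, then either $M$ has a $U_{s,2s}$-minor $U$ in which $E(U) \cap A$ and $E(U) \cap B$ are bases of $U$, or $M$ has a $tU_{1,2}$-minor $N$ in which $E(N) \cap A$ and $E(N) \cap B$ are bases of $N$.
   Context: $tU_{1,2}$ denotes the direct sum of $t$ copies of $U_{1,2}$. *)

theory Defs
  imports Main
begin

datatype 'a set_system = Set_System (ground: "'a set") (indeps: "'a set set")

text \<open>Matroids are finite.\<close>

definition matroid :: "'a set_system \<Rightarrow> bool" where
  "matroid M \<longleftrightarrow>
     finite (ground M) \<and>
     (\<forall>X \<in> indeps M. X \<subseteq> ground M) \<and>
     {} \<in> indeps M \<and>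
     (\<forall>X Y. X \<in> indeps M \<longrightarrow> Y \<subseteq> X \<longrightarrow> Y \<in> indeps M) \<and>
     (\<forall>X Y. X \<in> indeps M \<longrightarrow> Y \<in> indeps M \<longrightarrow> card X < card Y \<longrightarrow>
        (\<exists>e \<in> Y - X. insert e X \<in> indeps M))"

definition basis :: "'a set_system \<Rightarrow> 'a set \<Rightarrow> bool" where
  "basis M B \<longleftrightarrow> B \<in> indeps M \<and> (\<forall>X \<in> indeps M. B \<subseteq> X \<longrightarrow> X = B)"

definition rank_of :: "'a set_system \<Rightarrow> 'a set \<Rightarrow> nat" where
  "rank_of M X = Max (card ` {I \<in> indeps M. I \<subseteq> X})"

abbreviation rank :: "'a set_system \<Rightarrow> nat" where
  "rank M \<equiv> rank_of M (ground M)"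

text \<open>The bases of the dual are the complements of the bases of \<open>M\<close>, so its independent sets
  are the subsets of the ground set that avoid some basis of \<open>M\<close>.\<close>

definition dual :: "'a set_system \<Rightarrow> 'a set_system" where
  "dual M = Set_System (ground M) {X. X \<subseteq> ground M \<and> (\<exists>B. basis M B \<and> X \<inter> B = {})}"

definition delete :: "'a set_system \<Rightarrow> 'a set \<Rightarrow> 'a set_system" where
  "delete M D = Set_System (ground M - D) {X \<in> indeps M. X \<subseteq> ground M - D}"

definition contract :: "'a set_system \<Rightarrow> 'a set \<Rightarrow> 'a set_system" where
  "contract M C = dual (delete (dual M) C)"

definition minor_of :: "'a set_system \<Rightarrow> 'a set_system \<Rightarrow> bool" where
  "minor_of N M \<longleftrightarrow>
     (\<exists>C D. C \<subseteq> ground M \<and> D \<subseteq> ground M \<and> C \<inter> D = {} \<and> N = delete (contract M C) D)"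

definition isomorphic :: "'a set_system \<Rightarrow> 'b set_system \<Rightarrow> bool" where
  "isomorphic M N \<longleftrightarrow>
     (\<exists>f. bij_betw f (ground M) (ground N) \<and>
          (\<forall>X. X \<subseteq> ground M \<longrightarrow> (X \<in> indeps M \<longleftrightarrow> f ` X \<in> indeps N)))"

definition uniform :: "nat \<Rightarrow> nat \<Rightarrow> nat set_system" where
  "uniform r n = Set_System {..<n} {X. X \<subseteq> {..<n} \<and> card X \<le> r}"

text \<open>The ground sets of the summands are made disjoint by tagging each element with its index.\<close>

definition direct_sum :: "'i set \<Rightarrow> ('i \<Rightarrow> 'a set_system) \<Rightarrow> ('i \<times> 'a) set_system" where
  "direct_sum J M = Set_System (SIGMA i:J. ground (M i))
     {X. X \<subseteq> (SIGMA i:J. ground (M i)) \<and> (\<forall>i \<in> J. {x. (i, x) \<in> X} \<in> indeps (M i))}"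

definition copies :: "nat \<Rightarrow> 'a set_system \<Rightarrow> (nat \<times> 'a) set_system" where
  "copies t M = direct_sum {..<t} (\<lambda>_. M)"

end

theory Submission
  imports Defs
begin

text \<open>
  Take a basis \<open>S\<close> of a rank-\<open>s\<close> minor and points \<open>f j\<close> of that minor, and greedily add points
  to \<open>S\<close> while the result stays uniform of rank \<open>s\<close>. Either \<open>s\<close> points get added, which gives
  \<open>U\<^bsub>s,2s\<^esub>\<close>, or at some moment every further point lies on one of the at most \<open>4\<^sup>s/2\<close> hyperplanes
  spanned by the fewer than \<open>2s\<close> points chosen so far, so one hyperplane contains a fraction
  \<open>2/4\<^sup>s\<close> of them.

  This is used twice. With \<open>S \<subseteq> A\<close> and points \<open>B\<close>, the dense hyperplane carries a pair of large
  disjoint bases of its span in a minor, and one element of \<open>A\<close> and one of \<open>B\<close> lie off it. Each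
  repetition divides the rank by about \<open>4\<^sup>s\<close>, so a rank \<open>4\<^bsup>s n\<^esup>\<close> yields a triangular sequence: \<open>b\<^sub>i\<close>
  is spanned by \<open>a\<^sub>0, \<dots>, a\<^sub>i\<close> but not by \<open>a\<^sub>0, \<dots>, a\<^bsub>i-1\<^esub>\<close>. In a triangular sequence let \<open>S\<close>
  consist of the first \<open>s\<close> elements \<open>a\<^sub>i\<close> and draw the \<open>k\<close>-th new point from the \<open>k\<close>-th of \<open>s\<close>
  consecutive intervals of the \<open>b\<^sub>j\<close>. The points spanning the dense hyperplane then precede those
  lying on it, and contracting them makes some pair \<open>a\<^sub>i, b\<^sub>i\<close> with \<open>i < s\<close> parallel and skew to a
  triangular sequence that is shorter by the factor \<open>s 4\<^sup>s\<close>; so \<open>t\<close> pairs can be split off.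
\<close>

section \<open>Averaging over a finite cover\<close>

text \<open>If every piece met \<open>T\<close> in fewer than \<open>card T / N\<close> elements, at
  most \<open>N\<close> pieces could not cover it. The pieces will be the sets of indices whose
  points lie on one candidate hyperplane.\<close>

lemma pigeonhole_cover:
  assumes "finite F" "finite T" "T \<subseteq> (\<Union>Z\<in>F. G Z)" "card F \<le> N" "0 < card T"
  shows "\<exists>Z\<in>F. card T \<le> N * card (T \<inter> G Z)"
proof (rule ccontr)
  assume "\<not> ?thesis"
  then have lt: "N * card (T \<inter> G Z) < card T" if "Z \<in> F" for Z using that by auto
  have "T = (\<Union>Z\<in>F. T \<inter> G Z)" using assms(3) by blast
  then have "card T \<le> (\<Sum>Z\<in>F. card (T \<inter> G Z))" using card_UN_le[OF assms(1)] by metis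
  then have "N * card T \<le> (\<Sum>Z\<in>F. N * card (T \<inter> G Z))" by (simp add: sum_distrib_left[symmetric])
  also have "\<dots> \<le> (\<Sum>Z\<in>F. card T - 1)"
  proof (rule sum_mono)
    fix Z assume "Z \<in> F" then show "N * card (T \<inter> G Z) \<le> card T - 1" using lt[of Z] by linarith
  qed
  also have "\<dots> \<le> N * (card T - 1)" using assms(4) by simp
  finally have "N * card T \<le> N * (card T - 1)" .
  moreover have "F \<noteq> {}" using assms(3,5) by auto
  then have "0 < N" using assms(1,4) by (metis card_gt_0_iff gr0I le_zero_eq card_0_eq)
  ultimately show False using assms(5) by simp
qed

subsection \<open>Closure, exchange and contraction\<close>

locale finite_matroid =
  fixes M :: "'a set_system"
  assumes matroid: "matroid M"
begin

abbreviation E where "E \<equiv> ground M"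
abbreviation indep where "indep X \<equiv> X \<in> indeps M"
abbreviation rk where "rk \<equiv> rank_of M"

text \<open>\<open>X\<close> may leave \<open>E\<close>: since \<open>rk\<close> sees only
  independent subsets, elements outside \<open>E\<close> do not affect the closure, and
  \<open>X \<subseteq> cl X\<close> requires \<open>X \<subseteq> E\<close>.\<close>

definition cl :: "'a set \<Rightarrow> 'a set" where
  "cl X = {e \<in> E. rk (insert e X) = rk X}"

lemma finite_ground: "finite E"
  and indep_ground: "indep X \<Longrightarrow> X \<subseteq> E"
  and indep_empty: "indep {}"
  and indep_subset: "indep X \<Longrightarrow> Y \<subseteq> X \<Longrightarrow> indep Y"
  and augment: "indep X \<Longrightarrow> indep Y \<Longrightarrow> card X < card Y \<Longrightarrow> \<exists>e \<in> Y - X. indep (insert e X)"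
  using matroid unfolding matroid_def by blast+

lemma indep_finite: "indep X \<Longrightarrow> finite X"
  using finite_ground indep_ground finite_subset by blast

lemma finite_indeps: "finite {I \<in> indeps M. I \<subseteq> X}"
  by (rule finite_subset[of _ "Pow E"]) (use indep_ground finite_ground in auto)

lemma card_le_rk: "indep I \<Longrightarrow> I \<subseteq> X \<Longrightarrow> card I \<le> rk X"
  unfolding rank_of_def by (rule Max_ge) (use finite_indeps in auto)

lemma rk_attained: obtains J where "indep J" "J \<subseteq> X" "card J = rk X"
proof -
  have "rk X \<in> card ` {I \<in> indeps M. I \<subseteq> X}"
    unfolding rank_of_def by (rule Max_in) (use finite_indeps indep_empty in auto)
  then show thesis using that by auto
qed

lemma ex_extend_to_basis:
  "indep I \<Longrightarrow> I \<subseteq> X \<Longrightarrow> \<exists>J. indep J \<and> I \<subseteq> J \<and> J \<subseteq> X \<and> card J = rk X"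
proof (induction "rk X - card I" arbitrary: I rule: less_induct)
  case less
  show ?case
  proof (cases "card I = rk X")
    case True
    then show ?thesis using less.prems by blast
  next
    case False
    have lt: "card I < rk X" using card_le_rk[OF less.prems] False by simp
    obtain J where J: "indep J" "J \<subseteq> X" "card J = rk X" by (rule rk_attained)
    obtain e where e: "e \<in> J - I" "indep (insert e I)"
      using augment[OF less.prems(1) J(1)] lt J(3) by auto
    have "card (insert e I) = Suc (card I)" using e indep_finite[OF less.prems(1)] by simp
    then have "rk X - card (insert e I) < rk X - card I" using lt by simp
    moreover have "insert e I \<subseteq> X" using e(1) J(2) less.prems(2) by blast
    ultimately obtain K where "indep K" "insert e I \<subseteq> K" "K \<subseteq> X" "card K = rk X"
      using less.hyps e(2) by blast
    then show ?thesis by blast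
  qed
qed

lemma extend_to_basis:
  assumes "indep I" "I \<subseteq> X"
  obtains J where "indep J" "I \<subseteq> J" "J \<subseteq> X" "card J = rk X"
  using ex_extend_to_basis[OF assms] by blast

lemma cl_ground: "cl X \<subseteq> E"
  by (auto simp: cl_def)

text \<open>By augmentation from \<open>J\<close>, the rank of \<open>X\<close> grows on adding
  \<open>e\<close> exactly if \<open>e\<close> itself extends \<open>J\<close>. Any basis of
  \<open>X\<close> can serve as \<open>J\<close>, which reduces closure arguments to
  independence.\<close>

lemma mem_cl_basis_iff:
  assumes J: "indep J" "J \<subseteq> X" "card J = rk X"
  shows "e \<in> cl X \<longleftrightarrow> e \<in> E \<and> (e \<in> J \<or> \<not> indep (insert e J))"
proof (cases "e \<in> E")
  case True
  have "rk (insert e X) = rk X \<longleftrightarrow> e \<in> J \<or> \<not> indep (insert e J)"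
  proof
    assume eq: "rk (insert e X) = rk X"
    show "e \<in> J \<or> \<not> indep (insert e J)"
    proof (rule ccontr)
      assume "\<not> ?thesis"
      then have "card (insert e J) \<le> rk (insert e X)" "card (insert e J) = Suc (card J)"
        using card_le_rk[of "insert e J" "insert e X"] J indep_finite by auto
      then show False using eq J by simp
    qed
  next
    assume r: "e \<in> J \<or> \<not> indep (insert e J)"
    have ge: "rk X \<le> rk (insert e X)"
      using card_le_rk[of J "insert e X"] J by auto
    have "\<not> rk X < rk (insert e X)"
    proof
      assume lt: "rk X < rk (insert e X)"
      obtain I where I: "indep I" "I \<subseteq> insert e X" "card I = rk (insert e X)"
        by (rule rk_attained)
      obtain x where x: "x \<in> I - J" "indep (insert x J)"
        using augment[OF J(1) I(1)] lt I J by auto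
      \<comment> \<open>An element of \<open>X\<close> extending \<open>J\<close> would give an
        independent subset of \<open>X\<close> larger than \<open>rk X\<close>, so augmentation can
        only have added \<open>e\<close>.\<close>
      have "x \<notin> X"
        using card_le_rk[of "insert x J" X] x J indep_finite by auto
      then show False using x I r by auto
    qed
    then show "rk (insert e X) = rk X" using ge by simp
  qed
  then show ?thesis using True by (simp add: cl_def)
qed (simp add: cl_def)

lemma mem_cl_indep_iff:
  "indep I \<Longrightarrow> e \<in> cl I \<longleftrightarrow> e \<in> E \<and> (e \<in> I \<or> \<not> indep (insert e I))"
proof (rule mem_cl_basis_iff)
  assume I: "indep I"
  obtain J where J: "indep J" "J \<subseteq> I" "card J = rk I" by (rule rk_attained)
  show "card I = rk I"
    using card_le_rk[OF I subset_refl] card_mono[OF indep_finite[OF I] J(2)] J(3) by simp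
qed auto

lemma indep_insert: "indep I \<Longrightarrow> e \<in> E \<Longrightarrow> e \<notin> cl I \<Longrightarrow> indep (insert e I)"
  by (auto simp: mem_cl_indep_iff)

lemma not_mem_cl: "indep (insert e I) \<Longrightarrow> e \<notin> I \<Longrightarrow> e \<notin> cl I"
  using indep_subset[OF _ subset_insertI] by (auto simp: mem_cl_indep_iff)

lemma subset_cl: "X \<subseteq> E \<Longrightarrow> X \<subseteq> cl X"
  by (auto simp: cl_def insert_absorb)

lemma cl_mono:
  assumes "X \<subseteq> Y"
  shows "cl X \<subseteq> cl Y"
proof
  fix e assume e: "e \<in> cl X"
  obtain J where J: "indep J" "J \<subseteq> X" "card J = rk X" by (rule rk_attained)
  obtain K where K: "indep K" "J \<subseteq> K" "K \<subseteq> Y" "card K = rk Y"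
    using extend_to_basis[OF J(1), of Y] J(2) assms by auto
  have "e \<in> K \<or> \<not> indep (insert e K)"
    using e mem_cl_basis_iff[OF J] K(2) indep_subset[of "insert e K" "insert e J"] by auto
  then show "e \<in> cl Y" using mem_cl_basis_iff[OF K(1,3,4)] e cl_ground by auto
qed

text \<open>A larger independent set in \<open>X \<union> Y\<close> would augment a basis
  \<open>J\<close> of \<open>X\<close> by an element of \<open>cl X\<close>, and no such element
  extends \<open>J\<close>.\<close>

lemma rk_Un_cl:
  assumes "Y \<subseteq> cl X"
  shows "rk (X \<union> Y) = rk X"
proof -
  obtain J where J: "indep J" "J \<subseteq> X" "card J = rk X" by (rule rk_attained)
  obtain I where I: "indep I" "I \<subseteq> X \<union> Y" "card I = rk (X \<union> Y)" by (rule rk_attained)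
  have "\<not> rk X < rk (X \<union> Y)"
  proof
    assume "rk X < rk (X \<union> Y)"
    then obtain x where x: "x \<in> I - J" "indep (insert x J)"
      using augment[OF J(1) I(1)] I J by auto
    have "x \<in> cl X"
      using x I(2) assms subset_cl[of "X \<inter> E"] cl_mono[of "X \<inter> E" X] indep_ground[OF I(1)] by blast
    then show False using x mem_cl_basis_iff[OF J] by auto
  qed
  moreover have "rk X \<le> rk (X \<union> Y)" using card_le_rk[of J "X \<union> Y"] J by auto
  ultimately show ?thesis by simp
qed

text \<open>By \<open>rk_Un_cl\<close> a basis of \<open>X\<close> is still a basis of
  \<open>X \<union> Y\<close>, so both closures are tested on the same \<open>J\<close>.\<close>

lemma cl_least:
  assumes "Y \<subseteq> cl X"
  shows "cl Y \<subseteq> cl X"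
proof
  fix e assume e: "e \<in> cl Y"
  obtain J where J: "indep J" "J \<subseteq> X" "card J = rk X" by (rule rk_attained)
  have "e \<in> cl (X \<union> Y)" using e cl_mono[of Y "X \<union> Y"] by auto
  then show "e \<in> cl X"
    using mem_cl_basis_iff[OF J(1) _, of "X \<union> Y"] mem_cl_basis_iff[OF J] J rk_Un_cl[OF assms] by auto
qed

lemma card_le_of_subset_cl:
  assumes "indep I" "I \<subseteq> cl X" "finite X"
  shows "card I \<le> card X"
proof -
  obtain J where J: "indep J" "J \<subseteq> X" "card J = rk X" by (rule rk_attained)
  have "card I \<le> rk X" using card_le_rk[OF assms(1), of "X \<union> I"] rk_Un_cl[OF assms(2)] by simp
  also have "\<dots> \<le> card X" using card_mono[OF assms(3) J(2)] J(3) by simp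
  finally show ?thesis .
qed

text \<open>A basis of \<open>X\<close> has at least \<open>card I \<ge> card X\<close> elements,
  hence is all of \<open>X\<close>. This proves independence by counting after elements have been
  exchanged.\<close>

lemma indep_of_span:
  assumes "indep I" "I \<subseteq> cl X" "finite X" "card X \<le> card I"
  shows "indep X" and "card X = card I"
proof -
  obtain J where J: "indep J" "J \<subseteq> X" "card J = rk X" by (rule rk_attained)
  have "card I \<le> rk X" using card_le_rk[OF assms(1), of "X \<union> I"] rk_Un_cl[OF assms(2)] by simp
  then have "J = X" using J assms card_seteq[of X J] by simp
  then show "indep X" "card X = card I"
    using J card_le_of_subset_cl[OF assms(1-3)] assms(4) by auto
qed

text \<open>A point of \<open>X\<close> outside \<open>cl I\<close> would extend \<open>I\<close> to
  an independent set in \<open>cl X\<close> with more than \<open>card X\<close> elements.\<close>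

lemma span_of_card:
  assumes "indep I" "I \<subseteq> cl X" "finite X" "X \<subseteq> E" "card X \<le> card I"
  shows "X \<subseteq> cl I"
proof (rule ccontr)
  assume "\<not> ?thesis"
  then obtain x where x: "x \<in> X" "x \<notin> cl I" by auto
  have "indep (insert x I)" using indep_insert assms x by auto
  moreover have "insert x I \<subseteq> cl X" using x subset_cl assms by auto
  ultimately have "card (insert x I) \<le> card X" using card_le_of_subset_cl assms by auto
  moreover have "x \<notin> I" using x subset_cl indep_ground assms(1) by auto
  ultimately show False using assms indep_finite by auto
qed

lemma cl_basis: "indep J \<Longrightarrow> J \<subseteq> X \<Longrightarrow> card J = rk X \<Longrightarrow> cl J = cl X"
  by (rule set_eqI) (simp add: mem_cl_basis_iff mem_cl_indep_iff)

lemma cl_Un_cong: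
  assumes "cl X = cl Y"
  shows "cl (X \<union> Z) \<subseteq> cl (Y \<union> Z)"
proof -
  have "cl (X \<union> Z) = cl ((X \<union> Z) \<inter> E)"
  proof
    obtain K where K: "indep K" "K \<subseteq> X \<union> Z" "card K = rk (X \<union> Z)" by (rule rk_attained)
    have "cl K \<subseteq> cl ((X \<union> Z) \<inter> E)" using K(2) indep_ground[OF K(1)] by (intro cl_mono) blast
    then show "cl (X \<union> Z) \<subseteq> cl ((X \<union> Z) \<inter> E)" using cl_basis[OF K] by simp
  qed (rule cl_mono, blast)
  also have "\<dots> \<subseteq> cl (Y \<union> Z)"
  proof (rule cl_least)
    have "X \<inter> E \<subseteq> cl Y" using subset_cl[of "X \<inter> E"] cl_mono[of "X \<inter> E" X] assms by blast
    moreover have "Z \<inter> E \<subseteq> cl Z" using subset_cl[of "Z \<inter> E"] cl_mono[of "Z \<inter> E" Z] by blast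
    ultimately show "(X \<union> Z) \<inter> E \<subseteq> cl (Y \<union> Z)"
      using cl_mono[of Y "Y \<union> Z"] cl_mono[of Z "Y \<union> Z"] by blast
  qed
  finally show ?thesis .
qed

text \<open>This is the MacLane-Steinitz exchange property. If it failed, \<open>a\<close> and
  \<open>b\<close> together would extend a basis \<open>J\<close> of \<open>X\<close>, so
  \<open>b\<close> would not be spanned by \<open>a\<close> and \<open>J\<close>, that is, by
  \<open>a\<close> and \<open>X\<close>.\<close>

lemma exchange:
  assumes "b \<in> cl (insert a X)" "b \<notin> cl X" "a \<in> E"
  shows "a \<in> cl (insert b X)"
proof (rule ccontr)
  assume na: "a \<notin> cl (insert b X)"
  obtain J where J: "indep J" "J \<subseteq> X" "card J = rk X" by (rule rk_attained)
  have bE: "b \<in> E" using assms(1) cl_ground by blast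
  have bJ: "b \<notin> cl J" using assms(2) cl_mono[OF J(2)] by blast
  have aJ: "a \<notin> cl (insert b J)" using na cl_mono[of "insert b J" "insert b X"] J(2) by blast
  have "indep (insert a (insert b J))" using J(1) bE assms(3) bJ aJ by (simp add: indep_insert)
  then have ind: "indep (insert b (insert a J))" by (simp add: insert_commute)
  have "b \<in> cl (insert b X)" using subset_cl[of "{b}"] cl_mono[of "{b}" "insert b X"] bE by blast
  then have "b \<notin> insert a J" using na bJ subset_cl[OF indep_ground[OF J(1)]] by blast
  then have "b \<notin> cl (insert a J)" using not_mem_cl[OF ind] by simp
  then show False using cl_Un_cong[OF cl_basis[OF J, symmetric], of "{a}"] assms(1) by auto
qed

text \<open>The elements of \<open>X - Y\<close> are discarded one at a time. If some
  \<open>x\<close> were needed to span \<open>e\<close>, exchange would put \<open>x\<close> into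
  the span of \<open>e\<close> and \<open>X - {x}\<close>. That span lies in
  \<open>cl (I - {x})\<close> because \<open>Y\<close> avoids \<open>x\<close>, against the
  independence of \<open>I\<close>.\<close>

lemma cl_Int_indep:
  assumes I: "indep I" and "X \<subseteq> I" "Y \<subseteq> I" "e \<in> cl X" "e \<in> cl Y"
  shows "e \<in> cl (X \<inter> Y)"
  using assms(2,4)
proof (induction "card (X - Y)" arbitrary: X)
  case 0
  have "finite X" using indep_finite[OF I] 0(2) finite_subset by metis
  then have "X - Y = {}" using 0(1) by (metis card_0_eq finite_Diff)
  then have "X \<inter> Y = X" by blast
  then show ?case using 0(3) by simp
next
  case (Suc n)
  then obtain x where x: "x \<in> X - Y" by (metis card_eq_0_iff ex_in_conv nat.distinct(1))
  have eX: "e \<in> cl (X - {x})"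
  proof (rule ccontr)
    assume n: "e \<notin> cl (X - {x})"
    have xE: "x \<in> E" using x Suc.prems indep_ground[OF I] by auto
    have "insert x (X - {x}) = X" using x by auto
    then have "x \<in> cl (insert e (X - {x}))" using exchange[OF _ n xE] Suc.prems by auto
    moreover have "insert e (X - {x}) \<subseteq> cl (I - {x})"
      using assms(3,5) x Suc.prems(1) cl_mono[of Y "I - {x}"] subset_cl[of "I - {x}"]
        indep_ground[OF I] by blast
    ultimately have "x \<in> cl (I - {x})" using cl_least by blast
    moreover have "insert x (I - {x}) = I" using x Suc.prems by auto
    ultimately show False using not_mem_cl[of x "I - {x}"] I by auto
  qed
  have "X - {x} - Y = (X - Y) - {x}" by auto
  then have "n = card (X - {x} - Y)" using Suc.hyps(2) x by simp
  then have "e \<in> cl ((X - {x}) \<inter> Y)" using Suc.hyps(1) Suc.prems eX by auto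
  moreover have "(X - {x}) \<inter> Y = X \<inter> Y" using x by auto
  ultimately show ?case by simp
qed

section \<open>Bases, contraction and restriction\<close>

lemma basis_iff: "basis M B \<longleftrightarrow> indep B \<and> card B = rk E"
proof
  assume b: "basis M B"
  then have B: "indep B" by (simp add: basis_def)
  obtain J where "indep J" "B \<subseteq> J" "card J = rk E"
    using extend_to_basis[OF B indep_ground[OF B]] by blast
  then show "indep B \<and> card B = rk E" using b unfolding basis_def by auto
next
  assume B: "indep B \<and> card B = rk E"
  have "X = B" if "indep X" "B \<subseteq> X" for X
    using card_le_rk[OF that(1) indep_ground[OF that(1)]] B that indep_finite card_seteq by metis
  then show "basis M B" using B by (simp add: basis_def)
qed

lemma basis_spans: "basis M B \<Longrightarrow> E \<subseteq> cl B"
  using subset_cl[of E] mem_cl_basis_iff[of B E] mem_cl_indep_iff[of B] indep_ground[of B]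
  by (auto simp: basis_iff)

lemma ground_contract: "ground (contract M C) = E - C"
  by (simp add: contract_def dual_def delete_def)

text \<open>The bases of \<open>delete (dual M) C\<close> are the complements of the bases of
  \<open>M\<close> that contain \<open>C\<close>; independence of \<open>C\<close> ensures that such
  bases exist. Complementing again gives the usual description of contraction.\<close>

lemma indeps_contract:
  assumes C: "indep C"
  shows "indeps (contract M C) = {X. X \<subseteq> E - C \<and> indep (X \<union> C)}"
proof -
  define D where "D = delete (dual M) C"
  have gD: "ground D = E - C" by (simp add: D_def dual_def delete_def)
  have iD: "X \<in> indeps D \<longleftrightarrow> X \<subseteq> E - C \<and> (\<exists>B. basis M B \<and> X \<inter> B = {})" for X
    by (auto simp: D_def dual_def delete_def)
  have "(\<exists>B'. basis D B' \<and> X \<inter> B' = {}) \<longleftrightarrow> indep (X \<union> C)" if X: "X \<subseteq> E - C" for X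
  proof
    assume "\<exists>B'. basis D B' \<and> X \<inter> B' = {}"
    then obtain B' where B': "basis D B'" "X \<inter> B' = {}" by auto
    then obtain B2 where B2: "basis M B2" "B' \<inter> B2 = {}" "B' \<subseteq> E - C"
      unfolding basis_def iD by auto
    \<comment> \<open>\<open>B3\<close> is a basis of \<open>M\<close> that contains
      \<open>C\<close> and still avoids \<open>B'\<close>, which lies outside both \<open>C\<close>
      and \<open>B2\<close>. Maximality of \<open>B'\<close> in \<open>D\<close> then forces
      \<open>B' = E - B3\<close>.\<close>
    obtain B3 where B3: "indep B3" "C \<subseteq> B3" "B3 \<subseteq> C \<union> B2" "card B3 = rk (C \<union> B2)"
      using extend_to_basis[OF C, of "C \<union> B2"] by auto
    have "rk E \<le> rk (C \<union> B2)" using B2(1) card_le_rk[of B2 "C \<union> B2"] by (auto simp: basis_iff)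
    then have "basis M B3"
      using B3 card_le_rk[OF B3(1) indep_ground[OF B3(1)]] by (auto simp: basis_iff)
    then have "E - B3 \<in> indeps D" using B3 by (auto simp: iD)
    moreover have "B' \<subseteq> E - B3" using B2 B3 by auto
    ultimately have "B' = E - B3" using B' unfolding basis_def by auto
    then have "X \<union> C \<subseteq> B3" using X B' B3 by auto
    then show "indep (X \<union> C)" using B3 indep_subset by auto
  next
    assume ind: "indep (X \<union> C)"
    obtain B where B: "indep B" "X \<union> C \<subseteq> B" "card B = rk E"
      using extend_to_basis[OF ind indep_ground[OF ind]] by blast
    then have bB: "basis M B" by (simp add: basis_iff)
    have "Y = E - B" if Y: "Y \<in> indeps D" "E - B \<subseteq> Y" for Y
    proof -
      obtain B2 where B2: "basis M B2" "Y \<inter> B2 = {}" "Y \<subseteq> E - C" using Y by (auto simp: iD)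
      have "B2 \<subseteq> B" using B2 Y indep_ground[of B2] by (auto simp: basis_def)
      then have "B2 = B" using B2(1) bB by (auto simp: basis_def)
      then show ?thesis using B2 Y by auto
    qed
    then have "basis D (E - B)" unfolding basis_def using bB B by (auto simp: iD)
    then show "\<exists>B'. basis D B' \<and> X \<inter> B' = {}" using B by auto
  qed
  then show ?thesis unfolding contract_def D_def[symmetric] dual_def[of D] gD by auto
qed

text \<open>Contract \<open>C\<close> and delete everything else outside \<open>W\<close>. Both
  kinds of minor in the final result are produced in this form.\<close>

lemma minor_on:
  assumes C: "indep C" and W: "W \<subseteq> E - C"
  shows "minor_of (Set_System W {X. X \<subseteq> W \<and> indep (X \<union> C)}) M"
proof -
  have "(Set_System W {X. X \<subseteq> W \<and> indep (X \<union> C)}) = delete (contract M C) (E - C - W)"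
    unfolding delete_def ground_contract indeps_contract[OF C] using W by auto
  then show ?thesis
    unfolding minor_of_def using indep_ground[OF C]
    by (intro exI[of _ C] exI[of _ "E - C - W"]) auto
qed

subsection \<open>Uniform minors and dense hyperplanes\<close>

text \<open>Over the contracted set \<open>C\<close>, this is a uniform matroid of rank
  \<open>s\<close> on the \<open>2 * s\<close> elements of \<open>A' \<union> B'\<close>: the span
  condition bounds the rank by \<open>s\<close>, and the last clause makes all smaller sets
  independent, among them \<open>A'\<close> and \<open>B'\<close>. The case \<open>Z = {}\<close>
  makes \<open>C\<close> independent.\<close>

definition uniform_minor :: "nat \<Rightarrow> 'a set \<Rightarrow> 'a set \<Rightarrow> bool" where
  "uniform_minor s A B \<longleftrightarrow>
     (\<exists>C A' B'. A' \<subseteq> A \<and> B' \<subseteq> B \<and> A' \<inter> B' = {} \<and> card A' = s \<and> card B' = s \<and>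
        C \<inter> (A' \<union> B') = {} \<and> A' \<union> B' \<subseteq> cl (C \<union> A') \<and>
        (\<forall>Z \<subseteq> A' \<union> B'. card Z \<le> s \<longrightarrow> indep (C \<union> Z)))"

lemma uniform_minor_mono:
  "uniform_minor s A B \<Longrightarrow> A \<subseteq> A2 \<Longrightarrow> B \<subseteq> B2 \<Longrightarrow> uniform_minor s A2 B2"
  unfolding uniform_minor_def by (elim exE conjE, intro exI conjI; (assumption | rule order_trans))

text \<open>Over \<open>C\<close>, a dependent set of at most \<open>s\<close> elements containing
  \<open>e\<close> would put \<open>e\<close> into the span of at most \<open>s - 1\<close> elements
  of \<open>W\<close>, hence onto one of the excluded hyperplanes.\<close>

lemma extend_uniform:
  assumes s: "1 < s" and W: "finite W" "s \<le> card W" "C \<inter> W = {}"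
    and unif: "\<And>Z. Z \<subseteq> W \<Longrightarrow> card Z \<le> s \<Longrightarrow> indep (C \<union> Z)"
    and e: "e \<in> E" "\<And>Z. Z \<subseteq> W \<Longrightarrow> card Z = s - 1 \<Longrightarrow> e \<notin> cl (C \<union> Z)"
  shows "e \<notin> C \<union> W" and "\<And>Z. Z \<subseteq> insert e W \<Longrightarrow> card Z \<le> s \<Longrightarrow> indep (C \<union> Z)"
proof -
  \<comment> \<open>Since \<open>W\<close> has at least \<open>s\<close> elements, smaller sets can
    be enlarged to size \<open>s - 1\<close>, the only size the assumption on \<open>e\<close>
    speaks of.\<close>
  have ext: "\<exists>Z'. Z \<subseteq> Z' \<and> Z' \<subseteq> W \<and> card Z' = s - 1" if "Z \<subseteq> W" "card Z \<le> s - 1" for Z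
    using exists_subset_between[of Z "s - 1" W] that W by auto
  have far: "e \<notin> cl (C \<union> Z)" if Zs: "Z \<subseteq> W" "card Z \<le> s - 1" for Z
  proof -
    obtain Z' where Z': "Z \<subseteq> Z'" "Z' \<subseteq> W" "card Z' = s - 1" using ext[OF Zs] by blast
    show ?thesis using Z' e(2)[of Z'] cl_mono[of "C \<union> Z" "C \<union> Z'"] by blast
  qed
  have notin: "e \<notin> C \<union> Z" if "Z \<subseteq> W" "card Z \<le> s - 1" for Z
  proof -
    have "C \<union> Z \<subseteq> E" using indep_ground[OF unif[OF that(1)]] that(2) by linarith
    then show ?thesis using far[OF that] subset_cl by blast
  qed
  have "e \<notin> C \<union> {}" using notin[of "{}"] by simp
  \<comment> \<open>\<open>1 < s\<close> enters here: the singleton \<open>{e}\<close> must be small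
    enough for \<open>notin\<close>.\<close>
  moreover have "1 \<le> s - 1" using s by linarith
  then have "e \<notin> W" using notin[of "{e}"] by auto
  ultimately show "e \<notin> C \<union> W" by simp
  show "indep (C \<union> Z)" if Z: "Z \<subseteq> insert e W" "card Z \<le> s" for Z
  proof (cases "e \<in> Z")
    case True
    have "finite Z" using Z(1) W(1) finite_subset by blast
    then have c: "card (Z - {e}) \<le> s - 1" using True Z(2) by simp
    have sub: "Z - {e} \<subseteq> W" using Z(1) by blast
    have "indep (insert e (C \<union> (Z - {e})))"
      using indep_insert[OF unif[OF sub] e(1) far[OF sub c]] c by simp
    moreover have "insert e (C \<union> (Z - {e})) = C \<union> Z" using True by blast
    ultimately show ?thesis by simp
  next
    case False
    then show ?thesis using unif Z by blast
  qed
qed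

text \<open>The \<open>k\<close>-th greedy point is taken from \<open>T k\<close>, and if stage
  \<open>k\<close> is stuck, the hyperplanes spanned so far cover \<open>T k\<close>. Indices are
  counted in place of points, since \<open>f\<close> need not be injective. Letting \<open>T\<close>
  vary with \<open>k\<close> restricts \<open>Z\<close> to points from earlier index sets.\<close>

lemma uniform_or_dense_hyperplane:
  fixes f :: "'i \<Rightarrow> 'a"
  assumes s: "1 < s" and S: "card S = s" "indep (C \<union> S)" "C \<inter> S = {}"
    and T: "\<And>k. k < s \<Longrightarrow> finite (T k)" "\<And>k j. k < s \<Longrightarrow> j \<in> T k \<Longrightarrow> f j \<in> cl (C \<union> S)"
  shows "uniform_minor s S (f ` (\<Union>k<s. T k)) \<or>
    (\<exists>k<s. \<exists>Z \<subseteq> S \<union> f ` (\<Union>i<k. T i). card Z = s - 1 \<and> C \<inter> Z = {} \<and> indep (C \<union> Z) \<and>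
       2 * card (T k) \<le> 4 ^ s * card {j \<in> T k. f j \<in> cl (C \<union> Z)})"
    (is "_ \<or> (\<exists>k<s. ?dense k)")
proof (cases "\<exists>k<s. ?dense k")
  case False
  have "k \<le> s \<Longrightarrow> \<exists>Y \<subseteq> f ` (\<Union>i<k. T i). card Y = k \<and> finite Y \<and> Y \<inter> S = {} \<and> C \<inter> Y = {} \<and>
    (\<forall>Z \<subseteq> S \<union> Y. card Z \<le> s \<longrightarrow> indep (C \<union> Z))" for k
  proof (induction k)
    case 0
    have "\<forall>Z \<subseteq> S. indep (C \<union> Z)" using indep_subset[OF S(2)] by blast
    then show ?case by (intro exI[of _ "{}"]) simp
  next
    case (Suc k)
    then obtain Y where Y: "Y \<subseteq> f ` (\<Union>i<k. T i)" "card Y = k" "finite Y" "Y \<inter> S = {}" "C \<inter> Y = {}"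
      and unif: "\<And>Z. Z \<subseteq> S \<union> Y \<Longrightarrow> card Z \<le> s \<Longrightarrow> indep (C \<union> Z)"
      by (metis Suc_leD)
    have k: "k < s" using Suc.prems by simp
    have finS: "finite S" using S(1) s card.infinite by fastforce
    have cW: "card (S \<union> Y) = s + k" using card_Un_disjoint[of S Y] S(1) Y finS by blast
    have "\<exists>j\<in>T k. \<forall>Z. Z \<subseteq> S \<union> Y \<longrightarrow> card Z = s - 1 \<longrightarrow> f j \<notin> cl (C \<union> Z)"
    proof (rule ccontr)
      assume n: "\<not> ?thesis"
      define F where "F = {Z. Z \<subseteq> S \<union> Y \<and> card Z = s - 1}"
      define G where "G Z = {j. f j \<in> cl (C \<union> Z)}" for Z
      have finF: "finite F" unfolding F_def using finS Y(3) by simp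
      \<comment> \<open>At stage \<open>k < s\<close> there are at most \<open>2 * s - 1\<close>
        points, so the number of hyperplanes is at most half of \<open>4 ^ s\<close>. This is the
        origin of the factor 2 in the density bound.\<close>
      have "card F = (s + k) choose (s - 1)" unfolding F_def using n_subsets[of "S \<union> Y" "s - 1"] cW finS Y(3) by simp
      also have "\<dots> \<le> 2 ^ (s + k)" by (rule binomial_le_pow2)
      also have "\<dots> \<le> 2 ^ (2 * s - 1)" using k by (intro power_increasing) auto
      finally have cF: "card F \<le> 2 ^ (2 * s - 1)" .
      have "(2::nat) * 2 ^ (2 * s - 1) = 2 ^ (2 * s)" using s by (simp add: power_eq_if)
      then have two: "(2::nat) * 2 ^ (2 * s - 1) = 4 ^ s" by (simp add: power_mult)
      have "T k \<subseteq> (\<Union>Z\<in>F. G Z)" using n unfolding F_def G_def by blast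
      have "\<exists>Z\<in>F. card (T k) \<le> 2 ^ (2 * s - 1) * card (T k \<inter> G Z)"
      proof (cases "card (T k) = 0")
        \<comment> \<open>For an empty \<open>T k\<close> the averaging does not apply, but any
          \<open>Z\<close> of the right size satisfies the bound.\<close>
        case True
        obtain Z where "Z \<subseteq> S \<union> Y" "card Z = s - 1"
          using obtain_subset_with_card_n[of "s - 1" "S \<union> Y"] cW by (metis diff_le_self trans_le_add1)
        then have "\<exists>Z. Z \<in> F" unfolding F_def by blast
        then show ?thesis using True by auto
      next
        case False
        then show ?thesis using pigeonhole_cover[OF finF T(1)[OF k] \<open>T k \<subseteq> _\<close> cF] by simp
      qed
      then obtain Z where Z: "Z \<in> F" "card (T k) \<le> 2 ^ (2 * s - 1) * card (T k \<inter> G Z)" by blast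
      have "T k \<inter> G Z = {j \<in> T k. f j \<in> cl (C \<union> Z)}" by (auto simp: G_def)
      then have "2 * card (T k) \<le> 4 ^ s * card {j \<in> T k. f j \<in> cl (C \<union> Z)}"
        using Z(2) mult_le_mono2[OF Z(2), of 2] by (simp add: two[symmetric] mult.assoc)
      moreover have "Z \<subseteq> S \<union> f ` (\<Union>i<k. T i)" "card Z = s - 1" "C \<inter> Z = {}" "indep (C \<union> Z)"
        using Z(1) Y S(3) unif[of Z] unfolding F_def by auto
      ultimately have "?dense k" by blast
      then show False using False k by blast
    qed
    then obtain j where j: "j \<in> T k" "\<And>Z. Z \<subseteq> S \<union> Y \<Longrightarrow> card Z = s - 1 \<Longrightarrow> f j \<notin> cl (C \<union> Z)"
      by blast
    have jE: "f j \<in> E" using T(2)[OF k j(1)] cl_ground by blast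
    have "finite (S \<union> Y)" "s \<le> card (S \<union> Y)" "C \<inter> (S \<union> Y) = {}" using cW finS Y S(3) by auto
    note new = extend_uniform[OF s this unif jE j(2)]
    have "insert (f j) Y \<subseteq> f ` (\<Union>i<Suc k. T i)" using Y(1) j(1) by (fastforce simp: less_Suc_eq)
    moreover have "card (insert (f j) Y) = Suc k" using new(1) Y by simp
    moreover have "\<forall>Z \<subseteq> S \<union> insert (f j) Y. card Z \<le> s \<longrightarrow> indep (C \<union> Z)" using new(2) by simp
    ultimately show ?case using new(1) Y by (intro exI[of _ "insert (f j) Y"]) simp
  qed
  from this[of s] obtain Y where Y: "Y \<subseteq> f ` (\<Union>i<s. T i)" "card Y = s" "Y \<inter> S = {}" "C \<inter> Y = {}"
    and unif: "\<forall>Z \<subseteq> S \<union> Y. card Z \<le> s \<longrightarrow> indep (C \<union> Z)"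
    by blast
  have "Y \<subseteq> cl (C \<union> S)" using Y(1) T(2) by blast
  moreover have "S \<subseteq> cl (C \<union> S)" using subset_cl[OF indep_ground[OF S(2)]] by blast
  ultimately have "uniform_minor s S (f ` (\<Union>k<s. T k))"
    unfolding uniform_minor_def using Y S unif
    by (intro exI[of _ C] exI[of _ S] exI[of _ Y]) (simp add: Int_Un_distrib Int_commute)
  then show ?thesis ..
qed blast

subsection \<open>Triangular sequences\<close>

text \<open>For vectors this says that, modulo \<open>C\<close>, the coordinates of the
  \<open>b i\<close> with respect to the \<open>a i\<close> form a triangular matrix with nonzero
  diagonal. Arbitrary finite index sets let a subsequence keep its indices.\<close>

definition triangular :: "'a set \<Rightarrow> nat set \<Rightarrow> (nat \<Rightarrow> 'a) \<Rightarrow> (nat \<Rightarrow> 'a) \<Rightarrow> bool" where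
  "triangular C I a b \<longleftrightarrow>
     finite I \<and> inj_on a I \<and> C \<inter> a ` I = {} \<and> indep (C \<union> a ` I) \<and>
     (\<forall>i\<in>I. b i \<in> cl (C \<union> a ` {j \<in> I. j \<le> i}) \<and> b i \<notin> cl (C \<union> a ` {j \<in> I. j < i}))"

section \<open>Long triangular sequences from a pair of bases\<close>

text \<open>\<open>C \<union> (A - S) \<union> Z\<close> spans a hyperplane of the span of
  \<open>C \<union> A\<close>. Contract \<open>Z\<close> and suitable elements of
  \<open>A - S\<close>, so that the rest of \<open>A - S\<close> and a basis of the part of
  \<open>B\<close> on the hyperplane become two bases of one minor. Contracting \<open>Z\<close>
  costs at most \<open>s - 1\<close> elements of \<open>B\<close>, and neither \<open>A\<close> nor
  \<open>B\<close> fits into the hyperplane.\<close>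

lemma basis_peel_hyperplane:
  assumes A: "indep (C \<union> A)" "C \<inter> A = {}" and B: "indep (C \<union> B)" "C \<inter> B = {}"
    and span: "B \<subseteq> cl (C \<union> A)" "A \<subseteq> cl (C \<union> B)"
    and S: "S \<subseteq> A" "card S = s" "0 < s"
    and Z: "Z \<subseteq> S \<union> B" "card Z = s - 1" "(C \<union> (A - S)) \<inter> Z = {}" "indep (C \<union> (A - S) \<union> Z)"
  shows "\<exists>C' A' J a b. C \<subseteq> C' \<and> A' \<subseteq> A \<and> J \<subseteq> B \<and> C' \<inter> A' = {} \<and> C' \<inter> J = {} \<and>
    indep (C' \<union> A') \<and> indep (C' \<union> J) \<and> J \<subseteq> cl (C' \<union> A') \<and> A' \<subseteq> cl (C' \<union> J) \<and>
    card {b \<in> B. b \<in> cl (C \<union> (A - S) \<union> Z)} \<le> card J + (s - 1) \<and>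
    a \<in> A \<and> b \<in> B \<and> a \<notin> cl (C' \<union> A') \<and> b \<notin> cl (C' \<union> A') \<and>
    C' \<union> A' \<subseteq> cl (C \<union> A) \<and> C \<union> A \<subseteq> cl (insert a (C' \<union> A'))"
proof -
  define H where "H = C \<union> (A - S) \<union> Z"
  define J0 where "J0 = {b \<in> B. b \<in> cl H}"
  have fin: "finite C" "finite A" "finite B" using indep_finite[OF A(1)] indep_finite[OF B(1)] by auto
  have finS: "finite S" using S(1) fin(2) finite_subset by blast
  have finZ: "finite Z" using Z(1) finS fin(3) finite_subset by blast
  have H: "indep H" using Z(4) by (simp add: H_def)
  have CZ: "indep (C \<union> Z)" by (rule indep_subset[OF H]) (auto simp: H_def)
  have "C \<union> Z \<subseteq> C \<union> Z \<union> J0" by blast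
  \<comment> \<open>The elements of \<open>K\<close> beyond \<open>C \<union> Z\<close> form a
    basis, modulo \<open>C \<union> Z\<close>, of the part of \<open>B\<close> on the
    hyperplane.\<close>
  then obtain K where K: "indep K" "C \<union> Z \<subseteq> K" "K \<subseteq> C \<union> Z \<union> J0" "card K = rk (C \<union> Z \<union> J0)"
    using extend_to_basis[OF CZ] by metis
  define J where "J = K - (C \<union> Z)"
  have KJ: "K = C \<union> Z \<union> J" "(C \<union> Z) \<inter> J = {}" "J \<subseteq> J0" using K by (auto simp: J_def)
  have "K \<subseteq> K \<union> (A - S)" by blast
  then obtain G where G: "indep G" "K \<subseteq> G" "G \<subseteq> K \<union> (A - S)" "card G = rk (K \<union> (A - S))"
    using extend_to_basis[OF K(1)] by metis
  \<comment> \<open>\<open>D\<close> holds the elements of \<open>A - S\<close> that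
    \<open>K\<close> lacks for spanning \<open>A - S\<close>. Once \<open>D\<close> is contracted
    too, \<open>A'\<close> and \<open>J\<close> span each other, since
    \<open>C' \<union> A' = H\<close> and \<open>C' \<union> J = G\<close>.\<close>
  define D where "D = G - K"
  define C' where "C' = C \<union> Z \<union> D"
  define A' where "A' = A - S - D"
  have D: "D \<subseteq> A - S" "G = K \<union> D" "K \<inter> D = {}" using G by (auto simp: D_def)
  have CA: "C' \<union> A' = H" using D by (auto simp: C'_def A'_def H_def)
  have CJ: "C' \<union> J = G" using D KJ by (auto simp: C'_def)
  have disjA: "C' \<inter> A' = {}" using Z(3) A(2) by (auto simp: C'_def A'_def)
  have disjJ: "C' \<inter> J = {}" using KJ D(3) by (auto simp: C'_def)
  have "J \<subseteq> cl (C' \<union> A')" using KJ(3) by (auto simp: CA J0_def)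
  moreover have "A' \<subseteq> cl (C' \<union> J)"
  proof -
    have "A - S \<subseteq> E" using indep_ground[OF H] by (auto simp: H_def)
    then have "A - S \<subseteq> cl (K \<union> (A - S))" using subset_cl cl_mono[of "A - S" "K \<union> (A - S)"] by blast
    then show ?thesis using cl_basis[OF G(1,3,4)] by (auto simp: CJ A'_def)
  qed
  moreover have "card J0 \<le> card J + (s - 1)"
  proof -
    have J0: "indep (C \<union> J0)" by (rule indep_subset[OF B(1)]) (auto simp: J0_def)
    have fJ0: "finite J0" using fin(3) by (simp add: J0_def)
    have "card C + card J0 = card (C \<union> J0)"
      using B(2) fin fJ0 by (subst card_Un_disjoint) (auto simp: J0_def)
    also have "\<dots> \<le> card K" using card_le_rk[OF J0, of "C \<union> Z \<union> J0"] K(4) by auto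
    also have "\<dots> = card (C \<union> Z) + card J"
      unfolding KJ(1) using KJ fJ0 fin finZ by (intro card_Un_disjoint) (auto intro: finite_subset)
    also have "\<dots> \<le> card C + card Z + card J" using card_Un_le[of C Z] by simp
    finally show ?thesis using Z(2) by simp
  qed
  moreover have Hsub: "H \<subseteq> cl (C \<union> A)"
  proof -
    have CA: "C \<union> A \<subseteq> cl (C \<union> A)" using subset_cl[OF indep_ground[OF A(1)]] .
    have "S \<union> B \<subseteq> cl (C \<union> A)" by (rule Un_least[OF order_trans[OF _ CA] span(1)]) (use S(1) in auto)
    then have "Z \<subseteq> cl (C \<union> A)" by (rule order_trans[OF Z(1)])
    moreover have "C \<union> (A - S) \<subseteq> cl (C \<union> A)" by (rule order_trans[OF _ CA]) auto
    ultimately show ?thesis unfolding H_def by (rule Un_least[rotated])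
  qed
  \<comment> \<open>\<open>H\<close> trades the \<open>s\<close> elements of \<open>S\<close> for
    the \<open>s - 1\<close> elements of \<open>Z\<close>, which makes it one element too small to
    span \<open>A\<close>.\<close>
  moreover have cards: "card (C \<union> A) = Suc (card H)"
  proof -
    have "card H = card (C \<union> (A - S)) + card Z"
      unfolding H_def using Z(3) fin finZ by (intro card_Un_disjoint) auto
    also have "card (C \<union> (A - S)) = card C + card (A - S)"
      using A(2) fin by (intro card_Un_disjoint) auto
    also have "card (A - S) = card A - s" using S finS by (simp add: card_Diff_subset)
    moreover have "card (C \<union> A) = card C + card A" using A(2) fin by (intro card_Un_disjoint) auto
    moreover have "s \<le> card A" using S fin card_mono by blast
    ultimately show ?thesis using Z(2) S(3) by simp
  qed
  have finH: "finite H" using indep_finite[OF H] .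
  have nA: "\<not> A \<subseteq> cl H"
  proof
    assume "A \<subseteq> cl H"
    moreover have "C \<subseteq> cl H" using subset_cl[OF indep_ground[OF H]] by (auto simp: H_def)
    ultimately show False using card_le_of_subset_cl[OF A(1) _ finH] cards by simp
  qed
  then obtain a where a: "a \<in> A" "a \<notin> cl H" by blast
  \<comment> \<open>\<open>C \<union> B\<close> spans \<open>A\<close>, so \<open>B\<close> cannot
    lie on the hyperplane either.\<close>
  have "\<not> B \<subseteq> cl H"
  proof
    assume "B \<subseteq> cl H"
    moreover have "C \<subseteq> cl H" using subset_cl[OF indep_ground[OF H]] by (auto simp: H_def)
    ultimately have "cl (C \<union> B) \<subseteq> cl H" by (intro cl_least) blast
    then show False using span(2) nA by blast
  qed
  then obtain b where b: "b \<in> B" "b \<notin> cl H" by blast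
  have "C \<union> A \<subseteq> cl (insert a H)"
  proof (rule span_of_card)
    have AE: "C \<union> A \<subseteq> E" using indep_ground[OF A(1)] .
    then show "indep (insert a H)" using indep_insert[OF H] a by blast
    show "insert a H \<subseteq> cl (C \<union> A)" using Hsub subset_cl[OF AE] a(1) by blast
    show "finite (C \<union> A)" "C \<union> A \<subseteq> E" using fin AE by auto
    have "a \<notin> H" using a(2) subset_cl[OF indep_ground[OF H]] by blast
    then show "card (C \<union> A) \<le> card (insert a H)" using cards finH by simp
  qed
  moreover have "C \<subseteq> C'" "A' \<subseteq> A" "J \<subseteq> B" using KJ(3) by (auto simp: C'_def A'_def J0_def)
  moreover have "indep (C' \<union> A')" "indep (C' \<union> J)" using H G(1) by (simp_all only: CA CJ)
  ultimately show ?thesis using disjA disjJ a b unfolding H_def[symmetric] J0_def[symmetric]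
    by - (rule exI[of _ C'], rule exI[of _ A'], rule exI[of _ J], rule exI[of _ a],
        rule exI[of _ b], simp only: CA, blast)
qed

text \<open>The index \<open>n\<close> exceeds all earlier ones, so the initial segments for
  \<open>i < n\<close> do not change and only the top pair has to be checked.\<close>

lemma triangular_snoc:
  assumes t: "triangular C {..<n} a b"
    and x: "x \<in> E" "x \<notin> cl (C \<union> a ` {..<n})"
    and y: "y \<in> cl (insert x (C \<union> a ` {..<n}))" "y \<notin> cl (C \<union> a ` {..<n})"
  shows "triangular C {..<Suc n} (a(n := x)) (b(n := y))"
proof -
  let ?a = "a(n := x)" and ?b = "b(n := y)"
  have low: "?a ` {..<n} = a ` {..<n}" by auto
  have full: "?a ` {..<Suc n} = insert x (a ` {..<n})" by (simp only: lessThan_Suc image_insert low fun_upd_same)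
  have ind: "indep (C \<union> a ` {..<n})" and inj: "inj_on a {..<n}" and dis: "C \<inter> a ` {..<n} = {}"
    using t by (auto simp: triangular_def)
  have xn: "x \<notin> C \<union> a ` {..<n}" using x(2) subset_cl[OF indep_ground[OF ind]] by blast
  have "?b i \<in> cl (C \<union> ?a ` {j \<in> {..<Suc n}. j \<le> i}) \<and> ?b i \<notin> cl (C \<union> ?a ` {j \<in> {..<Suc n}. j < i})"
    if i: "i < Suc n" for i
  proof (cases "i = n")
    case True
    have "{j \<in> {..<Suc n}. j \<le> i} = {..<Suc n}" "{j \<in> {..<Suc n}. j < i} = {..<n}" using True by auto
    then show ?thesis using y True by (simp only: full low) simp
  next
    case False
    then have i: "i < n" using i by simp
    then have s: "{j \<in> {..<Suc n}. j \<le> i} = {j \<in> {..<n}. j \<le> i}"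
        "{j \<in> {..<Suc n}. j < i} = {j \<in> {..<n}. j < i}" by auto
    have im: "?a ` {j \<in> {..<n}. P j} = a ` {j \<in> {..<n}. P j}" for P by (intro image_cong) auto
    show ?thesis unfolding s im using t i False by (auto simp: triangular_def)
  qed
  moreover have "inj_on ?a {..<Suc n}" using inj xn by (auto simp: lessThan_Suc inj_on_def)
  moreover have "indep (C \<union> insert x (a ` {..<n}))" using indep_insert[OF ind x] by simp
  moreover have "C \<inter> insert x (a ` {..<n}) = {}" using xn dis by auto
  ultimately show ?thesis unfolding triangular_def full by auto
qed

text \<open>Each induction step peels off a hyperplane and puts a pair found off it on top of the
  sequence built inside it. The two span inclusions say that the sequence with \<open>C'\<close>
  spans exactly what \<open>C \<union> A\<close> does, so that the new pair is placed correctly. The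
  size bounds are conditional because for \<open>n = 0\<close> no elements may be left.\<close>

lemma uniform_or_triangular:
  assumes s: "1 < s"
  shows "\<lbrakk>indep (C \<union> A); C \<inter> A = {}; indep (C \<union> B); C \<inter> B = {}; B \<subseteq> cl (C \<union> A); A \<subseteq> cl (C \<union> B);
      0 < n \<Longrightarrow> 4 ^ (s * n) \<le> card A; 0 < n \<Longrightarrow> 4 ^ (s * n) \<le> card B\<rbrakk> \<Longrightarrow>
    uniform_minor s A B \<or>
    (\<exists>C' a b. triangular C' {..<n} a b \<and> a ` {..<n} \<subseteq> A \<and> b ` {..<n} \<subseteq> B \<and>
       C' \<union> a ` {..<n} \<subseteq> cl (C \<union> A) \<and> C \<union> A \<subseteq> cl (C' \<union> a ` {..<n}))"
proof (induction n arbitrary: C A B)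
  case 0
  \<comment> \<open>Contracting all of \<open>A\<close> keeps the span inclusions true for the empty
    sequence.\<close>
  have t: "triangular (C \<union> A) {..<0} (\<lambda>_. undefined) (\<lambda>_. undefined)"
    using 0 by (simp add: triangular_def)
  have "C \<union> A \<subseteq> cl (C \<union> A)" using subset_cl[OF indep_ground[OF 0(1)]] .
  with t show ?case
    by (intro disjI2 exI[of _ "C \<union> A"] exI[of _ "\<lambda>_. undefined"] conjI) simp_all
next
  case (Suc n)
  note A = Suc.prems(1,2) and B = Suc.prems(3,4) and span = Suc.prems(5,6)
  have cA: "4 ^ s * 4 ^ (s * n) \<le> card A" and cB: "4 ^ s * 4 ^ (s * n) \<le> card B"
    using Suc.prems(7,8) by (simp_all add: power_add)
  have s4: "s < 4 ^ s" by (rule less_exp[THEN order_less_le_trans]) (simp add: power_mono)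
  have "4 ^ s * 1 \<le> 4 ^ s * (4::nat) ^ (s * n)" by (intro mult_le_mono2) simp
  then have "s \<le> card A" using cA s4 by linarith
  then obtain S where S: "S \<subseteq> A" "card S = s" using obtain_subset_with_card_n by metis
  \<comment> \<open>Modulo \<open>C1\<close>, the set \<open>S\<close> is a basis of a rank
    \<open>s\<close> minor, and all of \<open>B\<close> is available at every stage.\<close>
  define C1 where "C1 = C \<union> (A - S)"
  have C1S: "C1 \<union> S = C \<union> A" using S by (auto simp: C1_def)
  have fB: "finite B" using indep_finite[OF B(1)] by simp
  have "uniform_minor s S (id ` (\<Union>k<s. B)) \<or>
    (\<exists>k<s. \<exists>Z \<subseteq> S \<union> id ` (\<Union>i<k. B). card Z = s - 1 \<and> C1 \<inter> Z = {} \<and> indep (C1 \<union> Z) \<and>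
       2 * card B \<le> 4 ^ s * card {j \<in> B. id j \<in> cl (C1 \<union> Z)})"
    by (rule uniform_or_dense_hyperplane[OF s S(2)])
      (use C1S A S fB span in \<open>auto simp: C1_def\<close>)
  then show ?case
  proof
    assume "uniform_minor s S (id ` (\<Union>k<s. B))"
    then have "uniform_minor s A B" by (rule uniform_minor_mono[OF _ S(1)]) auto
    then show ?thesis ..
  next
    assume "\<exists>k<s. \<exists>Z \<subseteq> S \<union> id ` (\<Union>i<k. B). card Z = s - 1 \<and> C1 \<inter> Z = {} \<and> indep (C1 \<union> Z) \<and>
       2 * card B \<le> 4 ^ s * card {j \<in> B. id j \<in> cl (C1 \<union> Z)}"
    then obtain k Z where "k < s" and Z0: "Z \<subseteq> S \<union> id ` (\<Union>i<k. B)" and Z: "card Z = s - 1" "C1 \<inter> Z = {}"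
      "indep (C1 \<union> Z)" and big: "2 * card B \<le> 4 ^ s * card {j \<in> B. id j \<in> cl (C1 \<union> Z)}"
      by blast
    have "id ` (\<Union>i<k. B) \<subseteq> B" by auto
    then have ZSB: "Z \<subseteq> S \<union> B" using Z0 by blast
    have "0 < s" using s by simp
    from basis_peel_hyperplane[OF A B span S this ZSB Z(1) Z(2,3)[unfolded C1_def]]
    obtain C' A' J x y where sub: "C \<subseteq> C'" "A' \<subseteq> A" "J \<subseteq> B"
      and IH: "indep (C' \<union> A')" "C' \<inter> A' = {}" "indep (C' \<union> J)" "C' \<inter> J = {}"
        "J \<subseteq> cl (C' \<union> A')" "A' \<subseteq> cl (C' \<union> J)"
      and cJ: "card {b \<in> B. b \<in> cl (C \<union> (A - S) \<union> Z)} \<le> card J + (s - 1)"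
      and xy: "x \<in> A" "y \<in> B" "x \<notin> cl (C' \<union> A')" "y \<notin> cl (C' \<union> A')"
      and sp: "C' \<union> A' \<subseteq> cl (C \<union> A)" "C \<union> A \<subseteq> cl (insert x (C' \<union> A'))"
      by blast
    have "2 * (4 ^ s * 4 ^ (s * n)) \<le> 4 ^ s * card {b \<in> B. b \<in> cl (C \<union> (A - S) \<union> Z)}"
      using order_trans[OF mult_le_mono2[OF cB, of 2] big] by (simp only: C1_def id_apply)
    then have "4 ^ s * (2 * 4 ^ (s * n)) \<le> 4 ^ s * card {b \<in> B. b \<in> cl (C \<union> (A - S) \<union> Z)}"
      by (simp only: mult.left_commute)
    \<comment> \<open>The factor 2 pays for the \<open>s - 1\<close> elements lost to
      \<open>Z\<close>, because \<open>s \<le> 4 ^ (s * n)\<close> for positive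
      \<open>n\<close>.\<close>
    then have "2 * 4 ^ (s * n) \<le> card J + (s - 1)" using cJ by simp
    moreover have "s \<le> 4 ^ (s * n)" if "0 < n"
    proof -
      have "(4::nat) ^ s \<le> 4 ^ (s * n)" using that by (intro power_increasing) auto
      then show ?thesis using s4 by linarith
    qed
    ultimately have bigJ: "4 ^ (s * n) \<le> card J" if "0 < n" using that by fastforce
    have fin: "finite (C' \<union> A')" using indep_finite[OF IH(1)] .
    have "C' \<union> J \<subseteq> cl (C' \<union> A')" using IH(5) subset_cl[OF indep_ground[OF IH(1)]] by blast
    from card_le_of_subset_cl[OF IH(3) this fin] have "card J \<le> card A'"
      using IH(2,4) fin indep_finite[OF IH(3)] by (simp add: card_Un_disjoint)
    then have bigA: "4 ^ (s * n) \<le> card A'" if "0 < n" using bigJ that by fastforce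
    have "uniform_minor s A' J \<or>
      (\<exists>C2 a b. triangular C2 {..<n} a b \<and> a ` {..<n} \<subseteq> A' \<and> b ` {..<n} \<subseteq> J \<and>
         C2 \<union> a ` {..<n} \<subseteq> cl (C' \<union> A') \<and> C' \<union> A' \<subseteq> cl (C2 \<union> a ` {..<n}))"
      by (rule Suc.IH[OF IH]) (use bigA bigJ in simp_all)
    then show ?thesis
    proof (elim disjE exE conjE)
      assume "uniform_minor s A' J"
      then have "uniform_minor s A B" using sub(2,3) by (rule uniform_minor_mono)
      then show ?thesis ..
    next
      fix C2 a b
      assume t: "triangular C2 {..<n} a b" "a ` {..<n} \<subseteq> A'" "b ` {..<n} \<subseteq> J"
        and eq: "C2 \<union> a ` {..<n} \<subseteq> cl (C' \<union> A')" "C' \<union> A' \<subseteq> cl (C2 \<union> a ` {..<n})"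
      let ?X = "C2 \<union> a ` {..<n}"
      \<comment> \<open>As \<open>?X\<close> spans the hyperplane exactly, \<open>x\<close> and
        \<open>y\<close> are off its span, while \<open>x\<close> added to it spans
        \<open>y\<close>: the triangular condition at index \<open>n\<close>.\<close>
      have clX: "cl ?X = cl (C' \<union> A')" using cl_least[OF eq(1)] cl_least[OF eq(2)] by (rule equalityI)
      have xE: "x \<in> E" using xy(1) indep_ground[OF A(1)] by blast
      have "indep ?X" using t(1) by (simp add: triangular_def)
      then have XE: "?X \<subseteq> E" by (rule indep_ground)
      then have "x \<in> cl (insert x ?X)" using subset_cl[of "insert x ?X"] xE by blast
      moreover have "C' \<union> A' \<subseteq> cl (insert x ?X)"
        by (rule order_trans[OF eq(2)]) (rule cl_mono, blast)
      ultimately have "insert x (C' \<union> A') \<subseteq> cl (insert x ?X)" by blast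
      then have CA: "C \<union> A \<subseteq> cl (insert x ?X)" by (rule order_trans[OF sp(2) cl_least])
      have "y \<in> cl (C \<union> A)" using xy(2) span(1) by blast
      then have "y \<in> cl (insert x ?X)" using cl_least[OF CA] by blast
      then have "triangular C2 {..<Suc n} (a(n := x)) (b(n := y))"
        using triangular_snoc[OF t(1) xE(1)] xy clX by simp
      moreover have "(a(n := x)) ` {..<Suc n} \<subseteq> A" "(b(n := y)) ` {..<Suc n} \<subseteq> B"
        using t(2,3) sub xy by (auto simp: lessThan_Suc)
      moreover have ins: "C2 \<union> (a(n := x)) ` {..<Suc n} = insert x ?X"
        by (auto simp: lessThan_Suc)
      moreover have "insert x ?X \<subseteq> cl (C \<union> A)"
        using order_trans[OF eq(1) cl_least[OF sp(1)]] subset_cl[OF indep_ground[OF A(1)]] xy(1) by blast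
      ultimately show ?thesis using CA
        by - (rule disjI2, rule exI[of _ C2], rule exI[of _ "a(n := x)"], rule exI[of _ "b(n := y)"],
            simp only: ins)
    qed
  qed
qed

section \<open>Splitting a pair off a triangular sequence\<close>

text \<open>The increasing enumeration of \<open>I\<close> matches initial segments with initial
  segments, and triangularity depends on the indices only through these.\<close>

lemma triangular_reindex:
  assumes "triangular C I a b"
  obtains e where "e ` {..<card I} = I" "triangular C {..<card I} (a \<circ> e) (b \<circ> e)"
proof -
  have fin: "finite I" using assms by (simp add: triangular_def)
  define e where "e = (!) (sorted_list_of_set I)"
  have mono: "e i < e j" if "i < j" "j < card I" for i j
    using that fin strict_sorted_list_of_set[of I] sorted_wrt_nth_less[of "(<)" "sorted_list_of_set I" i j]
    by (simp add: e_def)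
  have less: "e i < e j \<longleftrightarrow> i < j" if "i < card I" "j < card I" for i j
    using mono[of i j] mono[of j i] that by (cases i j rule: linorder_cases) auto
  have im: "e ` {..<card I} = I"
    using fin nth_image[of "card I" "sorted_list_of_set I"] by (simp add: e_def lessThan_atLeast0)
  have inj: "inj_on e {..<card I}"
  proof (rule inj_onI)
    fix i j assume "i \<in> {..<card I}" "j \<in> {..<card I}" "e i = e j"
    then show "i = j" using mono[of i j] mono[of j i] by (cases i j rule: linorder_cases) simp_all
  qed
  have le: "e ` {k \<in> {..<card I}. k \<le> i} = {j \<in> I. j \<le> e i}"
    and lt: "e ` {k \<in> {..<card I}. k < i} = {j \<in> I. j < e i}" if "i < card I" for i
  proof -
    have "{j \<in> I. P j} = {j \<in> e ` {..<card I}. P j}" for P by (simp only: im)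
    also have "{j \<in> e ` {..<card I}. P j} = e ` {k \<in> {..<card I}. P (e k)}" for P by blast
    finally have "{j \<in> I. P j} = e ` {k \<in> {..<card I}. P (e k)}" for P .
    moreover have "{k \<in> {..<card I}. e k < e i} = {k \<in> {..<card I}. k < i}"
      using less that by auto
    moreover have "{k \<in> {..<card I}. e k \<le> e i} = {k \<in> {..<card I}. k \<le> i}"
      using less that by (auto simp: not_less[symmetric])
    ultimately show "e ` {k \<in> {..<card I}. k \<le> i} = {j \<in> I. j \<le> e i}"
      "e ` {k \<in> {..<card I}. k < i} = {j \<in> I. j < e i}" by simp_all
  qed
  have "triangular C {..<card I} (a \<circ> e) (b \<circ> e)"
    unfolding triangular_def image_comp[symmetric] im
  proof (intro conjI ballI)
    show "inj_on (a \<circ> e) {..<card I}"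
      using assms inj im by (intro comp_inj_on) (auto simp: triangular_def)
    fix i assume "i \<in> {..<card I}"
    then have i: "i < card I" "e i \<in> I" using im by auto
    show "(b \<circ> e) i \<in> cl (C \<union> a ` e ` {k \<in> {..<card I}. k \<le> i})"
      "(b \<circ> e) i \<notin> cl (C \<union> a ` e ` {k \<in> {..<card I}. k < i})"
      unfolding le[OF i(1)] lt[OF i(1)] using assms i(2) by (auto simp: triangular_def)
  qed (use assms in \<open>auto simp: triangular_def\<close>)
  with im show ?thesis by (rule that)
qed

text \<open>\<open>Z\<close> uses only indices below \<open>p\<close>, whereas \<open>J\<close>
  starts at \<open>p\<close>. Hence \<open>K\<close>, made of \<open>C\<close>, \<open>Z\<close> and
  the \<open>a j\<close> with \<open>s \<le> j < p\<close>, spans a hyperplane in the span of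
  \<open>C\<close> and all \<open>a j\<close> with \<open>j < p\<close>. For the first
  \<open>a i\<close> off it, \<open>b i\<close> is off it too but in the span of \<open>K\<close>
  and \<open>a i\<close>, so the two are parallel modulo \<open>K\<close>. Intersecting spans inside
  one independent set keeps the pair off the larger \<open>L\<close> and keeps the sequence on
  \<open>J\<close> triangular.\<close>

lemma triangular_split:
  assumes t: "triangular C {..<n} a b" and p: "0 < s" "s \<le> p" "p \<le> n"
    and Z: "Z \<subseteq> a ` {..<s} \<union> b ` {s..<p}" "card Z = s - 1" "(C \<union> a ` {s..<n}) \<inter> Z = {}"
      "indep (C \<union> a ` {s..<n} \<union> Z)"
    and J: "J \<subseteq> {p..<n}" "\<forall>j\<in>J. b j \<in> cl (C \<union> a ` {s..<n} \<union> Z)"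
  shows "\<exists>C' i. i < n \<and> C \<subseteq> C' \<and> triangular C' J a b \<and> C' \<union> a ` J \<subseteq> cl (C \<union> a ` {..<n}) \<and>
    a i \<notin> cl (C' \<union> a ` J) \<and> b i \<notin> cl (C' \<union> a ` J) \<and> b i \<in> cl (insert (a i) C')"
proof -
  have inj: "inj_on a {..<n}" and dis: "C \<inter> a ` {..<n} = {}" and ind: "indep (C \<union> a ` {..<n})"
    using t by (auto simp: triangular_def)
  have b_in: "b i \<in> cl (C \<union> a ` {..i})" and b_out: "b i \<notin> cl (C \<union> a ` {..<i})" if "i < n" for i
  proof -
    have "{j \<in> {..<n}. j \<le> i} = {..i}" "{j \<in> {..<n}. j < i} = {..<i}" using that by auto
    moreover have "b i \<in> cl (C \<union> a ` {j \<in> {..<n}. j \<le> i}) \<and> b i \<notin> cl (C \<union> a ` {j \<in> {..<n}. j < i})"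
      using t that unfolding triangular_def by blast
    ultimately show "b i \<in> cl (C \<union> a ` {..i})" "b i \<notin> cl (C \<union> a ` {..<i})"
      by simp_all
  qed
  have aeq: "a i = a j \<longleftrightarrow> i = j" if "i < n" "j < n" for i j
    using inj that by (auto simp: inj_on_def)
  define K where "K = C \<union> Z \<union> a ` {s..<p}"
  define R where "R = a ` {p..<n}"
  define L where "L = K \<union> R"
  define F where "F = C \<union> a ` {..<p}"
  have split_sn: "{s..<n} = {s..<p} \<union> {p..<n}" and split_n: "{..<n} = {..<p} \<union> {p..<n}"
    using p by auto
  have Leq: "L = C \<union> a ` {s..<n} \<union> Z" by (auto simp: L_def K_def R_def split_sn)
  have L: "indep L" using Z(4) by (simp add: Leq)
  have K: "indep K" by (rule indep_subset[OF L]) (auto simp: L_def)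
  have FR: "F \<union> R = C \<union> a ` {..<n}" by (auto simp: F_def R_def split_n)
  have indFR: "indep (F \<union> R)" using ind by (simp add: FR)
  have F: "indep F" by (rule indep_subset[OF indFR]) auto
  have fin: "finite F" "finite K" "finite R" "finite C" "finite Z"
    using indep_finite[OF F] indep_finite[OF K] by (auto simp: R_def K_def)
  have Kin: "K \<subseteq> cl K" and Fin: "F \<subseteq> cl F" and FRin: "F \<union> R \<subseteq> cl (F \<union> R)"
    using subset_cl indep_ground K F indFR by blast+
  have KF: "K \<subseteq> cl F"
  proof -
    have bF: "b j \<in> cl F" if "j < p" for j
    proof -
      have "C \<union> a ` {..j} \<subseteq> F" using that by (auto simp: F_def)
      moreover have "b j \<in> cl (C \<union> a ` {..j})" using b_in that p by simp
      ultimately show ?thesis using cl_mono by blast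
    qed
    have CP: "C \<subseteq> cl F" "a ` {..<p} \<subseteq> cl F" using Fin by (auto simp: F_def)
    have "a ` {..<s} \<subseteq> a ` {..<p}" "a ` {s..<p} \<subseteq> a ` {..<p}" using p(2) by auto
    note sub = this[THEN order_trans[OF _ CP(2)]]
    have "b ` {s..<p} \<subseteq> cl F" using bF by (intro image_subsetI) simp
    with sub(1) have "Z \<subseteq> cl F" by (rule order_trans[OF Z(1) Un_least])
    then show ?thesis using CP(1) sub(2) unfolding K_def by (intro Un_least)
  qed
  have cF: "card F = Suc (card K)"
  proof -
    have "inj_on a {..<p}" "inj_on a {s..<p}" by (rule inj_on_subset[OF inj]; use p in auto)+
    then have c: "card (a ` {..<p}) = p" "card (a ` {s..<p}) = p - s" by (simp_all add: card_image)
    have "C \<inter> a ` {..<p} = {}" using dis p by fastforce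
    then have "card F = card C + p" unfolding F_def using fin c by (simp add: card_Un_disjoint)
    moreover have "(C \<union> Z) \<inter> a ` {s..<p} = {}"
      using \<open>C \<inter> a ` {..<p} = {}\<close> Z(3) by (auto simp: split_sn)
    then have "card K = card (C \<union> Z) + (p - s)" unfolding K_def using fin c by (simp add: card_Un_disjoint)
    moreover have "C \<inter> Z = {}" using Z(3) by blast
    then have "card (C \<union> Z) = card C + (s - 1)" using fin Z(2) by (simp add: card_Un_disjoint)
    ultimately show ?thesis using p by simp
  qed
  have "\<not> F \<subseteq> cl K" using card_le_of_subset_cl[OF F _ fin(2)] cF by auto
  moreover have "C \<subseteq> cl K" using Kin by (auto simp: K_def)
  ultimately have ex: "\<exists>i. i < p \<and> a i \<notin> cl K" by (auto simp: F_def)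
  \<comment> \<open>Minimality puts all earlier \<open>a k\<close> into \<open>cl K\<close>, so
    modulo \<open>K\<close> the triangular condition at \<open>i\<close> involves only
    \<open>a i\<close> and \<open>b i\<close>. The index is below \<open>s\<close> because the
    \<open>a k\<close> with \<open>s \<le> k < p\<close> belong to \<open>K\<close>.\<close>
  define i where "i = (LEAST i. i < p \<and> a i \<notin> cl K)"
  have i: "i < p" "a i \<notin> cl K" using LeastI_ex[OF ex] by (auto simp: i_def)
  have below: "a k \<in> cl K" if "k < i" for k
    using not_less_Least[of k "\<lambda>i. i < p \<and> a i \<notin> cl K"] that i(1) by (auto simp: i_def[symmetric])
  have ils: "i < s"
  proof (rule ccontr)
    assume "\<not> i < s"
    then have "a i \<in> K" using i(1) by (auto simp: K_def)
    then show False using Kin i(2) by blast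
  qed
  have iE: "a i \<in> E" using indep_ground[OF F] i(1) by (auto simp: F_def)
  have lowK: "C \<union> a ` {..<i} \<subseteq> cl K" using \<open>C \<subseteq> cl K\<close> below by auto
  have upto: "C \<union> a ` {..i} = insert (a i) (C \<union> a ` {..<i})"
    by (simp add: lessThan_Suc_atMost[symmetric] lessThan_Suc)
  have KK1: "cl K \<subseteq> cl (insert (a i) K)" by (intro cl_mono) blast
  have aiK1: "a i \<in> cl (insert (a i) K)" using subset_cl[of "insert (a i) K"] iE indep_ground[OF K] by blast
  have bi: "b i \<in> cl (insert (a i) K)"
  proof -
    have "C \<union> a ` {..i} \<subseteq> cl (insert (a i) K)" unfolding upto using lowK KK1 aiK1 by blast
    moreover have "b i \<in> cl (C \<union> a ` {..i})" using b_in i(1) p(3) by simp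
    ultimately show ?thesis using cl_least by blast
  qed
  \<comment> \<open>Otherwise exchange would span \<open>a i\<close> by \<open>b i\<close>,
    \<open>C\<close> and the earlier \<open>a k\<close>, all of them in \<open>cl K\<close>.\<close>
  have bi_out: "b i \<notin> cl K"
  proof
    assume bK: "b i \<in> cl K"
    have "i < n" using i(1) p(3) by simp
    from exchange[OF b_in[OF this, unfolded upto] b_out[OF this] iE]
    have "a i \<in> cl (insert (b i) (C \<union> a ` {..<i}))" .
    moreover have "insert (b i) (C \<union> a ` {..<i}) \<subseteq> cl K" using lowK bK by blast
    then have "cl (insert (b i) (C \<union> a ` {..<i})) \<subseteq> cl K" by (rule cl_least)
    ultimately show False using i(2) by blast
  qed
  \<comment> \<open>\<open>K1\<close> is a second basis of the span of \<open>F\<close>. With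
    \<open>R\<close> it forms the independent set in which all intersections of spans below take
    place.\<close>
  define K1 where "K1 = insert (a i) K"
  have K1: "indep K1" unfolding K1_def by (rule indep_insert[OF K iE i(2)])
  have aiK: "a i \<notin> K" using Kin i(2) by blast
  have cK1: "card K1 = card F" using aiK fin cF by (simp add: K1_def)
  have "a i \<in> F" using i(1) by (auto simp: F_def)
  then have "K1 \<subseteq> cl F" using KF Fin by (auto simp: K1_def)
  then have FK1: "F \<subseteq> cl K1" using span_of_card[OF K1] fin(1) indep_ground[OF F] cK1 by auto
  have FRR: "F \<inter> R = {}" using dis p aeq by (auto simp: F_def R_def)
  have RE: "R \<subseteq> E" using indep_ground[OF indFR] by auto
  have K1X: "F \<union> X \<subseteq> cl (K1 \<union> X)" if "X \<subseteq> E" for X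
  proof -
    have "cl K1 \<subseteq> cl (K1 \<union> X)" "cl X \<subseteq> cl (K1 \<union> X)" by (intro cl_mono; blast)+
    then show ?thesis using FK1 subset_cl[OF that] by blast
  qed
  have I: "indep (K1 \<union> R)"
  proof (rule indep_of_span[OF indFR K1X[OF RE]])
    show "finite (K1 \<union> R)" using fin by (simp add: K1_def)
    have "card (K1 \<union> R) \<le> card K1 + card R" by (rule card_Un_le)
    also have "\<dots> = card (F \<union> R)" using cK1 FRR fin by (simp add: card_Un_disjoint)
    finally show "card (K1 \<union> R) \<le> card (F \<union> R)" .
  qed
  have aiR: "a i \<notin> R"
  proof
    assume "a i \<in> R"
    then obtain j where "p \<le> j" "j < n" "a i = a j" by (auto simp: R_def)
    then show False using aeq[of i j] ils p by simp
  qed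
  have aiL: "a i \<notin> L" using aiK aiR by (simp add: L_def)
  have K1R: "K1 \<union> R = insert (a i) L" by (auto simp: K1_def L_def)
  have ai_out: "a i \<notin> cl L" using not_mem_cl[of "a i" L] I aiL by (simp add: K1R)
  have bi_outL: "b i \<notin> cl L"
  proof
    assume "b i \<in> cl L"
    then have "b i \<in> cl (L \<inter> K1)"
      using cl_Int_indep[OF I _ _ _ bi[folded K1_def]] by (auto simp: K1R K1_def L_def)
    moreover have "L \<inter> K1 = K" using aiL by (auto simp: K1_def L_def)
    ultimately show False using bi_out by simp
  qed
  have KR: "K \<inter> R = {}"
  proof -
    have "a ` {s..<p} \<inter> R = {}" using aeq p by (auto simp: R_def)
    moreover have "C \<inter> R = {}" using dis by (auto simp: R_def)
    moreover have "Z \<inter> R = {}" using Z(3) by (auto simp: R_def split_sn)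
    ultimately show ?thesis by (auto simp: K_def)
  qed
  \<comment> \<open>The \<open>a j\<close> with \<open>j \<ge> p\<close> outside \<open>J\<close>
    are contracted as well, so that \<open>C'\<close> and the remaining \<open>a j\<close> make up
    exactly \<open>L\<close>.\<close>
  define C' where "C' = K \<union> a ` ({p..<n} - J)"
  have C'J: "C' \<union> a ` J = L" using J(1) by (auto simp: C'_def L_def R_def)
  have disC': "C' \<inter> a ` J = {}"
  proof -
    have "a ` J \<subseteq> R" using J(1) by (auto simp: R_def)
    moreover have "a ` ({p..<n} - J) \<inter> a ` J = {}" using aeq J(1) by fastforce
    ultimately show ?thesis using KR by (auto simp: C'_def)
  qed
  have tri: "triangular C' J a b"
    unfolding triangular_def C'J
  proof (intro conjI ballI)
    show "finite J" using J(1) finite_subset by blast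
    show "inj_on a J" by (rule inj_on_subset[OF inj]) (use J(1) in auto)
    fix j assume j: "j \<in> J"
    then have jn: "p \<le> j" "j < n" using J(1) by auto
    have "a ` {p..j} \<subseteq> R" using jn by (auto simp: R_def)
    then have sub: "K1 \<union> a ` {p..j} \<subseteq> K1 \<union> R" and pE: "a ` {p..j} \<subseteq> E" using RE by auto
    have "{..j} = {..<p} \<union> {p..j}" using jn by auto
    then have "C \<union> a ` {..j} \<subseteq> F \<union> a ` {p..j}" by (simp add: F_def image_Un Un_assoc)
    then have "C \<union> a ` {..j} \<subseteq> cl (K1 \<union> a ` {p..j})" using K1X[OF pE] by blast
    then have bj: "b j \<in> cl (K1 \<union> a ` {p..j})" using cl_least b_in[OF jn(2)] by blast
    have "b j \<in> cl L" using bspec[OF J(2) j] by (simp add: Leq)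
    \<comment> \<open>Both sets lie in the independent set \<open>K1 \<union> R\<close>, and
      intersecting with \<open>L\<close> removes exactly \<open>a i\<close>.\<close>
    then have "b j \<in> cl (L \<inter> (K1 \<union> a ` {p..j}))"
      using cl_Int_indep[OF I _ sub _ bj] by (auto simp: K1R)
    moreover have "L \<inter> (K1 \<union> a ` {p..j}) \<subseteq> C' \<union> a ` {j' \<in> J. j' \<le> j}"
      using aiL jn by (auto simp: K1_def C'_def)
    ultimately show "b j \<in> cl (C' \<union> a ` {j' \<in> J. j' \<le> j})" using cl_mono by blast
    show "b j \<notin> cl (C' \<union> a ` {j' \<in> J. j' < j})"
    proof
      let ?V = "C' \<union> a ` {j' \<in> J. j' < j}"
      assume bV: "b j \<in> cl ?V"
      have VL: "?V \<subseteq> L" using C'J by auto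
      then have "?V \<subseteq> K1 \<union> R" unfolding K1R by blast
      \<comment> \<open>The intersection leaves only \<open>K\<close> and the \<open>a k\<close>
        with \<open>p \<le> k < j\<close>. As \<open>K\<close> is spanned by \<open>C\<close> and
        the \<open>a k\<close> with \<open>k < p\<close>, this contradicts \<open>b_out\<close> at
        \<open>j\<close>.\<close>
      from cl_Int_indep[OF I this sub bV bj]
      have "b j \<in> cl (?V \<inter> (K1 \<union> a ` {p..j}))" .
      moreover have "?V \<inter> (K1 \<union> a ` {p..j}) \<subseteq> K \<union> a ` {p..<j}"
      proof -
        have "a j \<notin> C'" using disC' j by auto
        moreover have "a j \<notin> a ` {j' \<in> J. j' < j}" using aeq jn J(1) by fastforce
        moreover have "{p..j} = insert j {p..<j}" using jn by auto
        ultimately show ?thesis using VL aiL by (auto simp: K1_def)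
      qed
      moreover have "K \<union> a ` {p..<j} \<subseteq> cl (C \<union> a ` {..<j})"
      proof -
        have "F \<subseteq> C \<union> a ` {..<j}" using jn by (auto simp: F_def)
        then have "K \<subseteq> cl (C \<union> a ` {..<j})" using KF cl_mono by blast
        moreover have "C \<union> a ` {..<j} \<subseteq> E" using indep_ground[OF ind] jn by auto
        then have "C \<union> a ` {..<j} \<subseteq> cl (C \<union> a ` {..<j})" by (rule subset_cl)
        then have "a ` {p..<j} \<subseteq> cl (C \<union> a ` {..<j})" by auto
        ultimately show ?thesis by blast
      qed
      ultimately have "b j \<in> cl (C \<union> a ` {..<j})" by (meson cl_least cl_mono order_trans subsetD)
      then show False using b_out[OF jn(2)] by simp
    qed
  qed (use disC' L in auto)
  have "C \<subseteq> C'" "K \<subseteq> C'" by (auto simp: C'_def K_def)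
  moreover from this have "b i \<in> cl (insert (a i) C')" using bi cl_mono[of "insert (a i) K" "insert (a i) C'"] by blast
  moreover have "L \<subseteq> cl (C \<union> a ` {..<n})"
  proof -
    have "cl F \<subseteq> cl (F \<union> R)" by (intro cl_mono) blast
    then have "K \<subseteq> cl (F \<union> R)" by (rule order_trans[OF KF])
    moreover have "R \<subseteq> cl (F \<union> R)" using FRin by simp
    ultimately show ?thesis unfolding L_def FR[symmetric] by (rule Un_least)
  qed
  ultimately show ?thesis using tri ai_out bi_outL i(1) p(3)
    by - (rule exI[of _ C'], rule exI[of _ i], unfold C'J, simp)
qed

subsection \<open>Parallel pairs\<close>

text \<open>This is the sum of \<open>t\<close> copies of the rank-one uniform matroid on two
  elements, over the contracted set \<open>C\<close>: the conditions on \<open>y i\<close> make it a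
  non-loop parallel to \<open>x i\<close>.\<close>

definition parallel_pairs :: "'a set \<Rightarrow> nat \<Rightarrow> (nat \<Rightarrow> 'a) \<Rightarrow> (nat \<Rightarrow> 'a) \<Rightarrow> bool" where
  "parallel_pairs C t x y \<longleftrightarrow>
     inj_on x {..<t} \<and> C \<inter> x ` {..<t} = {} \<and> indep (C \<union> x ` {..<t}) \<and>
     (\<forall>i<t. y i \<in> cl (insert (x i) C) \<and> y i \<notin> cl C)"

text \<open>The new pair is parallel over \<open>C\<close>, hence over the larger \<open>D\<close>,
  provided that \<open>v\<close> is not in \<open>cl D\<close>. Lying off \<open>cl X\<close>, which
  contains \<open>D\<close> and all earlier \<open>x i\<close>, gives this and keeps the
  \<open>x i\<close> independent.\<close>

lemma parallel_pairs_snoc: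
  assumes P: "parallel_pairs D t x y"
    and DC: "C \<subseteq> D" "D \<union> x ` {..<t} \<subseteq> cl X"
    and u: "u \<in> E" "u \<notin> cl X" and v: "v \<in> cl (insert u C)" "v \<notin> cl X"
  shows "parallel_pairs D (Suc t) (x(t := u)) (y(t := v))"
proof -
  let ?x = "x(t := u)" and ?y = "y(t := v)"
  have ind: "indep (D \<union> x ` {..<t})" using P by (simp add: parallel_pairs_def)
  have im: "?x ` {..<Suc t} = insert u (x ` {..<t})" by (auto simp: lessThan_Suc)
  have out: "u \<notin> cl (D \<union> x ` {..<t})" using cl_least[OF DC(2)] u(2) by blast
  then have ux: "u \<notin> D \<union> x ` {..<t}" using subset_cl[OF indep_ground[OF ind]] by blast
  have "cl D \<subseteq> cl X" using DC(2) by (intro cl_least) simp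
  then have vD: "v \<notin> cl D" using v(2) by blast
  have vuD: "v \<in> cl (insert u D)" using v(1) cl_mono[of "insert u C" "insert u D"] DC(1) by blast
  have "inj_on ?x {..<Suc t}" using P ux by (auto simp: parallel_pairs_def lessThan_Suc inj_on_def)
  moreover have "D \<inter> ?x ` {..<Suc t} = {}" unfolding im using P ux by (auto simp: parallel_pairs_def)
  moreover have "indep (D \<union> ?x ` {..<Suc t})" unfolding im using indep_insert[OF ind u(1) out] by simp
  moreover have "\<forall>i<Suc t. ?y i \<in> cl (insert (?x i) D) \<and> ?y i \<notin> cl D"
    using P vD vuD by (auto simp: parallel_pairs_def less_Suc_eq)
  ultimately show ?thesis unfolding parallel_pairs_def by blast
qed

text \<open>Each induction step splits off one pair and applies the hypothesis to the sequence on
  \<open>J\<close>. The conclusions about \<open>D\<close> and its span are what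
  \<open>parallel_pairs_snoc\<close> needs in order to add the split pair to those found
  later.\<close>

lemma uniform_or_parallel_pairs:
  assumes s: "1 < s"
  shows "triangular C {..<n} a b \<Longrightarrow> (s * 4 ^ s) ^ t \<le> n \<Longrightarrow>
    uniform_minor s (a ` {..<n}) (b ` {..<n}) \<or>
    (\<exists>D x y. parallel_pairs D t x y \<and> C \<subseteq> D \<and> D \<union> x ` {..<t} \<subseteq> cl (C \<union> a ` {..<n}) \<and>
       x ` {..<t} \<subseteq> a ` {..<n} \<and> y ` {..<t} \<subseteq> b ` {..<n})"
proof (induction t arbitrary: C n a b)
  case 0
  then have ind: "indep (C \<union> a ` {..<n})" by (simp add: triangular_def)
  have "parallel_pairs C 0 a b" using indep_subset[OF ind, of C] by (simp add: parallel_pairs_def)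
  moreover have "C \<subseteq> cl (C \<union> a ` {..<n})" using subset_cl[OF indep_ground[OF ind]] by simp
  ultimately show ?case
    by - (rule disjI2, rule exI[of _ C], rule exI[of _ a], rule exI[of _ b], simp)
next
  case (Suc t)
  note tri = Suc.prems(1)
  have ind: "indep (C \<union> a ` {..<n})" and inj: "inj_on a {..<n}" and dis: "C \<inter> a ` {..<n} = {}"
    using tri by (simp_all add: triangular_def)
  define q where "q = (s * 4 ^ s) ^ t"
  \<comment> \<open>The first \<open>s\<close> indices and \<open>s\<close> intervals of length
    \<open>m\<close> together take \<open>s * 4 ^ s * q\<close> indices; the subtracted 1 makes room
    for the first \<open>s\<close>.\<close>
  define m where "m = 4 ^ s * q - 1"
  have q: "0 < q" using s by (simp add: q_def)
  have pos: "0 < (4::nat) ^ s * q" using q by simp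
  have sm: "s + s * m = s * (4 ^ s * q)"
    unfolding m_def using pos by (metis One_nat_def Suc_pred mult_Suc_right)
  have smn: "s + s * m \<le> n" using Suc.prems(2) by (simp add: sm q_def mult.assoc)
  define S where "S = a ` {..<s}"
  define T where "T k = {s + k * m..<s + Suc k * m}" for k
  define C1 where "C1 = C \<union> a ` {s..<n}"
  have split: "{..<n} = {..<s} \<union> {s..<n}" using smn by auto
  have C1S: "C1 \<union> S = C \<union> a ` {..<n}" by (auto simp: C1_def S_def split)
  have injS: "inj_on a {..<s}" by (rule inj_on_subset[OF inj]) (use smn in auto)
  have cS: "card S = s" using injS by (simp add: S_def card_image)
  have C1S0: "C1 \<inter> S = {}"
  proof -
    have "a ` {s..<n} \<inter> a ` {..<s} = {}"
    proof -
      have "{s..<n} \<subseteq> {..<n}" "{..<s} \<subseteq> {..<n}" "{s..<n} \<inter> {..<s} = {}" using smn by auto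
      then show ?thesis using inj_on_image_Int[OF inj, of "{s..<n}" "{..<s}"] by simp
    qed
    moreover have "C \<inter> a ` {..<s} = {}" using dis split by auto
    ultimately show ?thesis by (auto simp: C1_def S_def)
  qed
  have Tn: "T k \<subseteq> {s..<s + Suc k * m}" "s + Suc k * m \<le> n" if "k < s" for k
  proof -
    have "Suc k * m \<le> s * m" using that by (intro mult_le_mono1) simp
    then show "s + Suc k * m \<le> n" using smn by linarith
    show "T k \<subseteq> {s..<s + Suc k * m}" by (auto simp: T_def)
  qed
  have bcl: "b j \<in> cl (C \<union> a ` {..<n})" if "j < n" for j
  proof -
    have "b j \<in> cl (C \<union> a ` {i \<in> {..<n}. i \<le> j})" using tri that unfolding triangular_def by blast
    moreover have "C \<union> a ` {i \<in> {..<n}. i \<le> j} \<subseteq> C \<union> a ` {..<n}" by auto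
    ultimately show ?thesis using cl_mono by blast
  qed
  have "uniform_minor s S (b ` (\<Union>k<s. T k)) \<or>
    (\<exists>k<s. \<exists>Z \<subseteq> S \<union> b ` (\<Union>i<k. T i). card Z = s - 1 \<and> C1 \<inter> Z = {} \<and> indep (C1 \<union> Z) \<and>
       2 * card (T k) \<le> 4 ^ s * card {j \<in> T k. b j \<in> cl (C1 \<union> Z)})"
  proof (rule uniform_or_dense_hyperplane[OF s cS _ C1S0])
    show "indep (C1 \<union> S)" using ind by (simp add: C1S)
    show "finite (T k)" for k by (simp add: T_def)
    show "b j \<in> cl (C1 \<union> S)" if "k < s" "j \<in> T k" for k j
      using Tn[OF that(1)] that(2) bcl[of j] by (force simp: C1S)
  qed
  then show ?case
  proof (elim disjE exE conjE)
    assume "uniform_minor s S (b ` (\<Union>k<s. T k))"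
    moreover have "S \<subseteq> a ` {..<n}" by (auto simp: S_def split)
    moreover have "(\<Union>k<s. T k) \<subseteq> {..<n}" using Tn by fastforce
    then have "b ` (\<Union>k<s. T k) \<subseteq> b ` {..<n}" by (rule image_mono)
    ultimately have "uniform_minor s (a ` {..<n}) (b ` {..<n})" by (rule uniform_minor_mono)
    then show ?thesis ..
  next
    fix k Z
    assume k: "k < s" and Z0: "Z \<subseteq> S \<union> b ` (\<Union>i<k. T i)"
      and Z: "card Z = s - 1" "C1 \<inter> Z = {}" "indep (C1 \<union> Z)"
      and big: "2 * card (T k) \<le> 4 ^ s * card {j \<in> T k. b j \<in> cl (C1 \<union> Z)}"
    define p where "p = s + k * m"
    define J where "J = {j \<in> T k. b j \<in> cl (C1 \<union> Z)}"
    have pn: "0 < s" "s \<le> p" "p \<le> n" using s Tn(2)[OF k] by (auto simp: p_def)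
    \<comment> \<open>The intervals before the \<open>k\<close>-th end at \<open>p\<close>, where
      the \<open>k\<close>-th begins. This is the separation that \<open>triangular_split\<close>
      asks for.\<close>
    have "(\<Union>i<k. T i) \<subseteq> {s..<p}"
    proof
      fix j assume "j \<in> (\<Union>i<k. T i)"
      then obtain i where i: "i < k" "s + i * m \<le> j" "j < s + Suc i * m" by (auto simp: T_def)
      have "Suc i * m \<le> k * m" using i(1) by (intro mult_le_mono1) simp
      then show "j \<in> {s..<p}" using i by (simp add: p_def)
    qed
    then have "b ` (\<Union>i<k. T i) \<subseteq> b ` {s..<p}" by (rule image_mono)
    then have Zsub: "Z \<subseteq> a ` {..<s} \<union> b ` {s..<p}"
      by (rule order_trans[OF Z0[unfolded S_def] Un_mono[OF subset_refl]])
    have Jsub: "J \<subseteq> {p..<n}" using Tn(2)[OF k] by (auto simp: J_def T_def p_def)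
    have Jcl: "\<forall>j\<in>J. b j \<in> cl (C \<union> a ` {s..<n} \<union> Z)" by (simp add: J_def C1_def)
    from triangular_split[OF tri pn Zsub Z(1) Z(2,3)[unfolded C1_def] Jsub Jcl]
    obtain C' i where i: "i < n" and C': "C \<subseteq> C'" and tJ: "triangular C' J a b"
      and sub: "C' \<union> a ` J \<subseteq> cl (C \<union> a ` {..<n})"
      and ai: "a i \<notin> cl (C' \<union> a ` J)" and bi: "b i \<notin> cl (C' \<union> a ` J)" "b i \<in> cl (insert (a i) C')"
      by blast
    obtain e where e: "e ` {..<card J} = J" and te: "triangular C' {..<card J} (a \<circ> e) (b \<circ> e)"
      using triangular_reindex[OF tJ] .
    \<comment> \<open>With at most \<open>q - 1\<close> elements in \<open>J\<close>,
      \<open>4 ^ s * card J\<close> would stay below \<open>m\<close>, so the subtracted 1 does no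
      harm.\<close>
    have cJ: "q \<le> card J"
    proof (rule ccontr)
      assume "\<not> q \<le> card J"
      then have "card J \<le> q - 1" by simp
      then have "4 ^ s * card J \<le> 4 ^ s * (q - 1)" by simp
      then have "4 ^ s * card J + 4 ^ s \<le> 4 ^ s * q" using q by (cases q) auto
      moreover have "2 * m \<le> 4 ^ s * card J" using big by (simp add: J_def T_def)
      moreover have "(4::nat) ^ 1 \<le> 4 ^ s" using s by (intro power_increasing) auto
      ultimately show False using pos by (simp add: m_def)
    qed
    have im: "(a \<circ> e) ` {..<card J} = a ` J" "(b \<circ> e) ` {..<card J} = b ` J"
      by (simp_all only: image_comp[symmetric] e)
    have Jn: "J \<subseteq> {..<n}" using Jsub by auto
    have aJ: "a ` J \<subseteq> a ` {..<n}" and bJ: "b ` J \<subseteq> b ` {..<n}" using Jn by (auto intro: image_mono)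
    from Suc.IH[OF te cJ[unfolded q_def]] show ?thesis
      unfolding im
    proof (elim disjE exE conjE)
      assume "uniform_minor s (a ` J) (b ` J)"
      then have "uniform_minor s (a ` {..<n}) (b ` {..<n})" using aJ bJ by (rule uniform_minor_mono)
      then show ?thesis ..
    next
      fix D x y
      assume P: "parallel_pairs D t x y" and D: "C' \<subseteq> D" "D \<union> x ` {..<t} \<subseteq> cl (C' \<union> a ` J)"
        and xy: "x ` {..<t} \<subseteq> a ` J" "y ` {..<t} \<subseteq> b ` J"
      let ?x = "x(t := a i)" and ?y = "y(t := b i)"
      have aiE: "a i \<in> E" using i indep_ground[OF ind] by auto
      have im: "?x ` {..<Suc t} = insert (a i) (x ` {..<t})" "?y ` {..<Suc t} = insert (b i) (y ` {..<t})"
        by (auto simp: lessThan_Suc)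
      have "parallel_pairs D (Suc t) ?x ?y"
        by (rule parallel_pairs_snoc[OF P D aiE ai bi(2) bi(1)])
      moreover have "C \<subseteq> D" using C' D(1) by (rule order_trans)
      moreover have "D \<union> ?x ` {..<Suc t} \<subseteq> cl (C \<union> a ` {..<n})"
      proof -
        have "D \<union> x ` {..<t} \<subseteq> cl (C \<union> a ` {..<n})" by (rule order_trans[OF D(2) cl_least[OF sub]])
        moreover have "a i \<in> cl (C \<union> a ` {..<n})" using subset_cl[OF indep_ground[OF ind]] i by auto
        ultimately show ?thesis unfolding im by simp
      qed
      moreover have "?x ` {..<Suc t} \<subseteq> a ` {..<n}" unfolding im using order_trans[OF xy(1) aJ] i by simp
      moreover have "?y ` {..<Suc t} \<subseteq> b ` {..<n}" unfolding im using order_trans[OF xy(2) bJ] i by simp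
      ultimately show ?thesis
        by - (rule disjI2, rule exI[of _ D], rule exI[of _ ?x], rule exI[of _ ?y], intro conjI)
    qed
  qed
qed

section \<open>From configurations to minors up to isomorphism\<close>

text \<open>Contract \<open>C\<close> and restrict to \<open>A' \<union> B'\<close>. Sets of more
  than \<open>s\<close> elements are dependent because \<open>C \<union> A'\<close> spans
  everything, so independence is a matter of cardinality and any bijection with
  \<open>{..<2 * s}\<close> is an isomorphism.\<close>

lemma uniform_minor_imp_isomorphic:
  assumes "uniform_minor s A B" "A \<inter> B = {}" "0 < s"
  shows "\<exists>U. minor_of U M \<and> isomorphic U (uniform s (2 * s)) \<and>
    basis U (ground U \<inter> A) \<and> basis U (ground U \<inter> B)"
proof -
  obtain C A' B' where sub: "A' \<subseteq> A" "B' \<subseteq> B" and dis: "A' \<inter> B' = {}" "C \<inter> (A' \<union> B') = {}"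
    and card: "card A' = s" "card B' = s" and span: "A' \<union> B' \<subseteq> cl (C \<union> A')"
    and unif: "\<forall>Z \<subseteq> A' \<union> B'. card Z \<le> s \<longrightarrow> indep (C \<union> Z)"
    using assms(1) unfolding uniform_minor_def by (elim exE conjE)
  let ?W = "A' \<union> B'"
  have fin: "finite ?W" using card assms(3) by (metis card.infinite finite_UnI less_irrefl)
  have indA: "indep (C \<union> A')" using unif card(1) by simp
  have finC: "finite C" using indep_finite[OF indA] by simp
  have C: "indep C" by (rule indep_subset[OF indA]) simp
  have indep_iff: "indep (X \<union> C) \<longleftrightarrow> card X \<le> s" if X: "X \<subseteq> ?W" for X
  proof
    assume ind: "indep (X \<union> C)"
    have "C \<subseteq> cl (C \<union> A')" using subset_cl[OF indep_ground[OF indA]] by simp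
    then have "X \<union> C \<subseteq> cl (C \<union> A')" using order_trans[OF X span] by simp
    from card_le_of_subset_cl[OF ind this indep_finite[OF indA]]
    have "card (X \<union> C) \<le> card (C \<union> A')" .
    moreover have "card (X \<union> C) = card X + card C"
      using X dis finC finite_subset[OF X fin] by (intro card_Un_disjoint) auto
    moreover have "card (C \<union> A') \<le> card C + s" using card_Un_le[of C A'] card(1) by simp
    ultimately show "card X \<le> s" by simp
  next
    assume "card X \<le> s"
    then have "indep (C \<union> X)" using unif X by blast
    then show "indep (X \<union> C)" by (simp only: Un_commute)
  qed
  define U where "U = Set_System ?W {X. X \<subseteq> ?W \<and> indep (X \<union> C)}"
  have gU: "ground U = ?W" and iU: "X \<in> indeps U \<longleftrightarrow> X \<subseteq> ?W \<and> card X \<le> s" for X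
    using indep_iff by (auto simp: U_def)
  have "?W \<subseteq> E - C" using span cl_ground dis(2) by blast
  then have minor: "minor_of U M" unfolding U_def by (rule minor_on[OF C])
  have basU: "basis U X" if X: "X \<subseteq> ?W" "card X = s" for X
  proof -
    have "Y = X" if "Y \<in> indeps U" "X \<subseteq> Y" for Y
      using card_seteq[of Y X] finite_subset[OF _ fin, of Y] that X by (auto simp: iU)
    then show ?thesis using X by (auto simp: basis_def iU)
  qed
  have "card ?W = 2 * s" using card dis(1) fin by (simp add: card_Un_disjoint)
  then obtain f where f: "bij_betw f ?W {..<2 * s}"
    using ex_bij_betw_finite_nat[OF fin] by (auto simp: lessThan_atLeast0)
  have "X \<in> indeps U \<longleftrightarrow> f ` X \<in> indeps (uniform s (2 * s))" if "X \<subseteq> ?W" for X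
  proof -
    have "inj_on f X" using f that by (auto simp: bij_betw_def intro: inj_on_subset)
    moreover have "f ` X \<subseteq> {..<2 * s}" using f that by (auto simp: bij_betw_def)
    ultimately show ?thesis using that by (simp add: iU uniform_def card_image)
  qed
  then have "isomorphic U (uniform s (2 * s))"
    unfolding isomorphic_def gU using f by (intro exI[of _ f]) (simp add: uniform_def)
  moreover have "ground U \<inter> A = A'" "ground U \<inter> B = B'" using sub assms(2) by (auto simp: gU)
  ultimately show ?thesis using minor basU[of A'] basU[of B'] card by (intro exI[of _ U]) simp
qed

text \<open>If \<open>X\<close> contains no full pair, complete it to a choice \<open>c\<close> of
  one element per pair. By exchange, these elements span every \<open>x i\<close> over
  \<open>D\<close>, and there are at most \<open>t\<close> of them, so \<open>indep_of_span\<close>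
  makes them independent over \<open>D\<close>.\<close>

lemma parallel_pairs_indep_iff:
  assumes P: "parallel_pairs D t x y" and xy: "x ` {..<t} \<inter> y ` {..<t} = {}"
    and X: "X \<subseteq> x ` {..<t} \<union> y ` {..<t}"
  shows "indep (X \<union> D) \<longleftrightarrow> (\<forall>i<t. \<not> (x i \<in> X \<and> y i \<in> X))"
proof -
  have ind: "indep (D \<union> x ` {..<t})" and dis: "D \<inter> x ` {..<t} = {}" and inj: "inj_on x {..<t}"
    and ycl: "\<And>i. i < t \<Longrightarrow> y i \<in> cl (insert (x i) D)" "\<And>i. i < t \<Longrightarrow> y i \<notin> cl D"
    using P by (auto simp: parallel_pairs_def)
  have D: "indep D" by (rule indep_subset[OF ind]) simp
  show ?thesis
  proof
    assume XD: "indep (X \<union> D)"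
    show "\<forall>i<t. \<not> (x i \<in> X \<and> y i \<in> X)"
    proof (intro allI impI notI)
      fix i assume i: "i < t" and "x i \<in> X \<and> y i \<in> X"
      then have "indep (insert (y i) (insert (x i) D))" by (intro indep_subset[OF XD]) auto
      moreover have "y i \<notin> D" using ycl(2)[OF i] subset_cl[OF indep_ground[OF D]] by blast
      moreover have "y i \<noteq> x i" using xy i by (metis disjoint_iff imageI lessThan_iff)
      ultimately show False using not_mem_cl[of "y i" "insert (x i) D"] ycl(1)[OF i] by simp
    qed
  next
    assume free: "\<forall>i<t. \<not> (x i \<in> X \<and> y i \<in> X)"
    define c where "c i = (if x i \<in> X then x i else y i)" for i
    have Xc: "X \<subseteq> c ` {..<t}"
    proof
      fix e assume e: "e \<in> X"
      then obtain i where i: "i < t" "e = x i \<or> e = y i" using X by blast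
      then have "e = c i" using e free by (auto simp: c_def)
      then show "e \<in> c ` {..<t}" using i(1) by simp
    qed
    let ?Q = "D \<union> c ` {..<t}"
    have QE: "?Q \<subseteq> E"
    proof -
      have "y i \<in> E" if "i < t" for i using ycl(1)[OF that] cl_ground by blast
      then show ?thesis using indep_ground[OF ind] by (auto simp: c_def)
    qed
    have "x i \<in> cl ?Q" if i: "i < t" for i
    proof -
      have xE: "x i \<in> E" using indep_ground[OF ind] i by auto
      have "x i \<in> cl (insert (y i) D)" using exchange[OF ycl(1)[OF i] ycl(2)[OF i] xE] .
      moreover have "x i \<in> cl (insert (x i) D)"
        using subset_cl[of "insert (x i) D"] xE indep_ground[OF D] by simp
      ultimately have "x i \<in> cl (insert (c i) D)" by (simp add: c_def)
      moreover have "cl (insert (c i) D) \<subseteq> cl ?Q" using i by (intro cl_mono) auto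
      ultimately show ?thesis by blast
    qed
    moreover have "D \<subseteq> cl ?Q" using subset_cl[OF QE] by simp
    ultimately have span: "D \<union> x ` {..<t} \<subseteq> cl ?Q" by auto
    have finD: "finite D" using indep_finite[OF D] .
    have "card ?Q \<le> card D + card (c ` {..<t})" by (rule card_Un_le)
    also have "\<dots> \<le> card D + t" using card_image_le[of "{..<t}" c] by simp
    also have "\<dots> = card (D \<union> x ` {..<t})" using dis inj finD by (simp add: card_Un_disjoint card_image)
    finally have "card ?Q \<le> card (D \<union> x ` {..<t})" .
    then have "indep ?Q" using indep_of_span(1)[OF ind span] finD by simp
    then show "indep (X \<union> D)" by (rule indep_subset) (use Xc in auto)
  qed
qed

text \<open>A common element \<open>y i = y j\<close> would lie in the spans of \<open>x i\<close>
  and of \<open>x j\<close> over \<open>D\<close>, hence in \<open>cl D\<close> by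
  \<open>cl_Int_indep\<close>.\<close>

lemma parallel_pairs_inj:
  assumes P: "parallel_pairs D t x y"
  shows "inj_on y {..<t}"
proof (rule inj_onI, rule ccontr)
  fix i j assume ij: "i \<in> {..<t}" "j \<in> {..<t}" "y i = y j" "i \<noteq> j"
  have ind: "indep (D \<union> x ` {..<t})" and ycl: "y i \<in> cl (insert (x i) D)" "y i \<in> cl (insert (x j) D)"
    "y i \<notin> cl D" and inj: "inj_on x {..<t}" and dis: "D \<inter> x ` {..<t} = {}"
    using P ij by (auto simp: parallel_pairs_def)
  have "y i \<in> cl (insert (x i) D \<inter> insert (x j) D)"
    by (rule cl_Int_indep[OF ind _ _ ycl(1,2)]) (use ij in auto)
  moreover have "x i \<noteq> x j" using inj ij by (auto simp: inj_on_def)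
  then have "insert (x i) D \<inter> insert (x j) D = D" using dis ij by auto
  ultimately show False using ycl(3) by simp
qed

lemma parallel_pairs_imp_isomorphic:
  assumes P: "parallel_pairs D t x y" and sub: "x ` {..<t} \<subseteq> A" "y ` {..<t} \<subseteq> B" and AB: "A \<inter> B = {}"
  shows "\<exists>N. minor_of N M \<and> isomorphic N (copies t (uniform 1 2)) \<and>
    basis N (ground N \<inter> A) \<and> basis N (ground N \<inter> B)"
proof -
  have ind: "indep (D \<union> x ` {..<t})" and dis: "D \<inter> x ` {..<t} = {}" and injx: "inj_on x {..<t}"
    and ycl: "\<And>i. i < t \<Longrightarrow> y i \<in> cl (insert (x i) D)" "\<And>i. i < t \<Longrightarrow> y i \<notin> cl D"
    using P by (auto simp: parallel_pairs_def)
  have D: "indep D" by (rule indep_subset[OF ind]) simp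
  have injy: "inj_on y {..<t}" by (rule parallel_pairs_inj[OF P])
  have xy: "x ` {..<t} \<inter> y ` {..<t} = {}" using sub AB by blast
  then have xny: "x i \<noteq> y j" if "i < t" "j < t" for i j using that by (metis disjoint_iff imageI lessThan_iff)
  have sep: "y i \<notin> x ` {..<t}" "x i \<notin> y ` {..<t}" if "i < t" for i using that xy by auto
  let ?W = "x ` {..<t} \<union> y ` {..<t}"
  define N where "N = Set_System ?W {X. X \<subseteq> ?W \<and> indep (X \<union> D)}"
  have gN: "ground N = ?W" by (simp add: N_def)
  have iN: "X \<in> indeps N \<longleftrightarrow> X \<subseteq> ?W \<and> (\<forall>i<t. \<not> (x i \<in> X \<and> y i \<in> X))" for X
    using parallel_pairs_indep_iff[OF P xy] by (auto simp: N_def)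
  have "y i \<in> E - D" if "i < t" for i
    using ycl(1,2)[OF that] cl_ground subset_cl[OF indep_ground[OF D]] by blast
  then have "?W \<subseteq> E - D" using indep_ground[OF ind] dis by auto
  then have minor: "minor_of N M" unfolding N_def by (rule minor_on[OF D])
  have basx: "basis N (x ` {..<t})"
    unfolding basis_def
  proof (intro conjI ballI impI)
    show "x ` {..<t} \<in> indeps N" using sep by (simp add: iN)
    \<comment> \<open>Anything added to the \<open>x i\<close> would be some \<open>y i\<close> and
      complete a pair.\<close>
    fix X assume X: "X \<in> indeps N" "x ` {..<t} \<subseteq> X"
    then have "y i \<notin> X" if "i < t" for i using that by (auto simp: iN)
    then show "X = x ` {..<t}" using X by (auto simp: iN)
  qed
  have basy: "basis N (y ` {..<t})"
    unfolding basis_def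
  proof (intro conjI ballI impI)
    show "y ` {..<t} \<in> indeps N" using sep by (simp add: iN)
    fix X assume X: "X \<in> indeps N" "y ` {..<t} \<subseteq> X"
    then have "x i \<notin> X" if "i < t" for i using that by (auto simp: iN)
    then show "X = y ` {..<t}" using X by (auto simp: iN)
  qed
  \<comment> \<open>\<open>g\<close> sends the tagged elements \<open>(i, 0)\<close> and
    \<open>(i, 1)\<close> of the direct sum to \<open>x i\<close> and \<open>y i\<close>. The
    isomorphism \<open>f\<close> is its inverse, and \<open>mem\<close> describes images under
    \<open>f\<close> through \<open>g\<close>.\<close>
  define G where "G = (SIGMA i:{..<t}. {..<2::nat})"
  define g where "g = (\<lambda>(i, k). if k = (0::nat) then x i else y i)"
  have two: "k < 2 \<longleftrightarrow> k = 0 \<or> k = 1" for k :: nat by auto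
  have "inj_on g G"
  proof (rule inj_onI)
    fix u v assume uv: "u \<in> G" "v \<in> G" "g u = g v"
    obtain i k j l where eq: "u = (i, k)" "v = (j, l)" by (metis surj_pair)
    show "u = v"
      using uv xny[of i j] xny[of j i] injx injy unfolding eq G_def g_def two
      by (auto simp: inj_on_def split: if_splits)
  qed
  moreover have "g ` G = ?W"
  proof
    show "g ` G \<subseteq> ?W" by (auto simp: g_def G_def)
    have "x i \<in> g ` G" "y i \<in> g ` G" if "i < t" for i
    proof -
      have "(i, 0) \<in> G" "(i, 1) \<in> G" using that by (simp_all add: G_def)
      moreover have "g (i, 0) = x i" "g (i, 1) = y i" by (simp_all add: g_def)
      ultimately show "x i \<in> g ` G" "y i \<in> g ` G" by (metis imageI)+
    qed
    then show "?W \<subseteq> g ` G" by auto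
  qed
  ultimately have g: "bij_betw g G ?W" by (simp add: bij_betw_def)
  define f where "f = inv_into G g"
  have f: "bij_betw f ?W G" unfolding f_def by (rule bij_betw_inv_into[OF g])
  have mem: "u \<in> f ` X \<longleftrightarrow> u \<in> G \<and> g u \<in> X" if X: "X \<subseteq> ?W" for u X
  proof -
    have gf: "g (f e) = e" if "e \<in> X" for e
      unfolding f_def using bij_betw_inv_into_right[OF g] that X by blast
    have fg: "f (g u) = u" if "u \<in> G" unfolding f_def using bij_betw_inv_into_left[OF g that] .
    have "f e \<in> G" if "e \<in> X" for e using f that X by (auto simp: bij_betw_def)
    then show ?thesis using gf fg by (metis image_iff)
  qed
  have gC: "ground (copies t (uniform 1 2)) = G"
    by (simp add: copies_def direct_sum_def uniform_def G_def)
  have "X \<in> indeps N \<longleftrightarrow> f ` X \<in> indeps (copies t (uniform 1 2))" if X: "X \<subseteq> ?W" for X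
  proof -
    \<comment> \<open>The summand with index \<open>i\<close> allows at most one of its two tags,
      which is the condition that \<open>X\<close> does not contain the whole pair.\<close>
    have row: "{k. (i, k) \<in> f ` X} \<in> indeps (uniform 1 2) \<longleftrightarrow> \<not> (x i \<in> X \<and> y i \<in> X)" if i: "i < t" for i
    proof -
      have "{k. (i, k) \<in> f ` X} = (if x i \<in> X then {0} else {}) \<union> (if y i \<in> X then {1} else {})"
        unfolding mem[OF X] using i by (auto simp: G_def g_def two split: if_splits)
      then show ?thesis by (simp add: uniform_def)
    qed
    have "f ` X \<subseteq> G" using f X by (auto simp: bij_betw_def)
    then have "f ` X \<in> indeps (copies t (uniform 1 2)) \<longleftrightarrow>
        (\<forall>i\<in>{..<t}. {k. (i, k) \<in> f ` X} \<in> indeps (uniform 1 2))"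
      by (simp add: copies_def direct_sum_def uniform_def G_def)
    also have "\<dots> \<longleftrightarrow> X \<in> indeps N" using row X by (simp add: iN Ball_def)
    finally show ?thesis by simp
  qed
  then have "isomorphic N (copies t (uniform 1 2))"
    unfolding isomorphic_def gC gN using f by blast
  moreover have "ground N \<inter> A = x ` {..<t}" "ground N \<inter> B = y ` {..<t}"
    using sub AB by (auto simp: gN)
  ultimately show ?thesis using minor basx basy by (intro exI[of _ N]) simp
qed

end

theorem theorem3p5:
  fixes M :: "'a set_system" and A B :: "'a set" and s t :: nat
  assumes "s \<ge> 2"
    and "matroid M"
    and "basis M A" and "basis M B" and "A \<inter> B = {}"
    and "rank M \<ge> 4 ^ (s * (s * 4 ^ s) ^ t)"
  shows "(\<exists>U. minor_of U M \<and> isomorphic U (uniform s (2 * s)) \<and>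
              basis U (ground U \<inter> A) \<and> basis U (ground U \<inter> B)) \<or>
         (\<exists>N. minor_of N M \<and> isomorphic N (copies t (uniform 1 2)) \<and>
              basis N (ground N \<inter> A) \<and> basis N (ground N \<inter> B))"
proof -
  interpret finite_matroid M by unfold_locales (rule assms(2))
  have s: "1 < s" using assms(1) by simp
  have A: "indep A" "card A = rk E" and B: "indep B" "card B = rk E"
    using assms(3,4) by (simp_all add: basis_iff)
  \<comment> \<open>The length \<open>?n\<close> is what \<open>t\<close> splittings consume, and
    \<open>4 ^ (s * ?n)\<close> is the assumed bound on the rank; the construction starts from
    \<open>A\<close> and \<open>B\<close> with nothing contracted.\<close>
  let ?n = "(s * 4 ^ s) ^ t"
  have AB: "B \<subseteq> cl A" "A \<subseteq> cl B"
    using basis_spans assms(3,4) indep_ground[OF A(1)] indep_ground[OF B(1)] by blast+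
  have "uniform_minor s A B \<or>
    (\<exists>C' a b. triangular C' {..<?n} a b \<and> a ` {..<?n} \<subseteq> A \<and> b ` {..<?n} \<subseteq> B \<and>
       C' \<union> a ` {..<?n} \<subseteq> cl ({} \<union> A) \<and> {} \<union> A \<subseteq> cl (C' \<union> a ` {..<?n}))"
    by (rule uniform_or_triangular[OF s]) (use A B AB assms(6) in simp_all)
  then consider "uniform_minor s A B"
    | D x y where "parallel_pairs D t x y" "x ` {..<t} \<subseteq> A" "y ` {..<t} \<subseteq> B"
  proof (elim disjE exE conjE)
    fix C' a b
    assume tri: "triangular C' {..<?n} a b" and ab: "a ` {..<?n} \<subseteq> A" "b ` {..<?n} \<subseteq> B"
    from uniform_or_parallel_pairs[OF s tri order_refl] show ?thesis
    proof (elim disjE exE conjE)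
      assume "uniform_minor s (a ` {..<?n}) (b ` {..<?n})"
      then show ?thesis using that(1) uniform_minor_mono[OF _ ab] by simp
    next
      fix D x y
      assume "parallel_pairs D t x y" "x ` {..<t} \<subseteq> a ` {..<?n}" "y ` {..<t} \<subseteq> b ` {..<?n}"
      then show ?thesis using that(2) order_trans[OF _ ab(1)] order_trans[OF _ ab(2)] by simp
    qed
  qed (rule that)
  then show ?thesis
  proof cases
    case 1
    then show ?thesis using uniform_minor_imp_isomorphic assms(5) s by simp
  next
    case 2
    then show ?thesis using parallel_pairs_imp_isomorphic assms(5) by simp
  qed
qed

end
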